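(* Let $P_0(\lambda):=\lambda^2M+K$ and $P_t(\lambda):=\lambda^2M+\lambda\,tD+K$ for $t>0$, where $M,D,K\in\mathbb C^{n\times n}$ are Hermitian with $M>0$, $D\ge0$ and $K>0$. Then $\Lambda(P_t)\cap i\mathbb R\subset\Lambda(P_0)$ for all $t>0$. (a) Let $i\omega\in\Lambda(P_0)$ ($\omega\in\mathbb R$) and let $m$ be the geometric multiplicity of $i\omega$ as an eigenvalue of $P_0$. If $\operatorname{rank}\begin{bmatrix}P_0(i\omega)&D\end{bmatrix}=n$, then $\pm i\omega\notin\Lambda(P_t)$ for all $t>0$. On the other hand, if $\operatorname{rank}\begin{bmatrix}P_0(i\omega)&D\end{bmatrix}=n-p$ with $p\ge1$, then $\pm i\omega\in\Lambda(P_t)$ for all $t>0$; further, $p$ is the geometric multiplicity of $\pm i\omega$ as an eigenvalue of $P_t(\lambda)$, and $\mathcal N(P_t(i\omega))=\mathcal N(P_1(i\omega))$ for all $t>0$. Hence $P_t(\lambda)$ removes $m-p$ eigenvalues $\pm i\omega$ (counting multiplicity) from the imaginary axis; that is, the multiplicity of each of $i\omega$ and $-i\omega$ is $m$ for $P_0$ and $p$ for $P_t$, $t>0$. (b) Let $\Lambda(P_1)\cap i\mathbb R=\{\pm i\omega_1,\ldots,\pm i\omega_\ell\}=:\sigma_0$, where the pairs $\pm i\omega_j$ are pairwise distinct, and let $\operatorname{rank}\begin{bmatrix}P_0(i\omega_j)&D\end{bmatrix}=n-p_j$ for $j=1,\ldots,\ell$. Set $p:=p_1+\cdots+p_\ell$.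 Then there exists an $M$-unitary matrix $X=\begin{bmatrix}X_1&X_2\end{bmatrix}$ with $X_2\in\mathbb C^{n\times p}$ such that $$X^*P_t(\lambda)X=\operatorname{diag}\big(\widetilde P_t(\lambda),\ \widetilde P_0(\lambda)\big)\quad\text{for all }t>0,$$ where $\widetilde P_0(\lambda):=\operatorname{diag}\big((\lambda^2+\omega_1^2)I_{p_1},\ldots,(\lambda^2+\omega_\ell^2)I_{p_\ell}\big)$ and $\widetilde P_t(\lambda):=X_1^*P_t(\lambda)X_1$. Furthermore, for all $t>0$, all eigenvalues of $\widetilde P_t(\lambda)$ have negative real parts, $\Lambda(\widetilde P_t)=\Lambda(P_t)\setminus\sigma_0$ and $\Lambda(\widetilde P_0)=\sigma_0$. The geometric multiplicity of a purely imaginary eigenvalue of $P_t(\lambda)$ remains the same for all $t>0$.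
   Context: For Hermitian matrices $X>0$ ($X\ge0$) means positive (semi)definite; $A^*$ is the conjugate transpose; $\mathcal N(X)$ is the nullspace of $X$. For a square matrix polynomial $R(\lambda)$ with $\det R\not\equiv0$, $\Lambda(R):=\{\lambda\in\mathbb C:\det R(\lambda)=0\}$ is its set of eigenvalues; the geometric multiplicity of $\mu\in\Lambda(R)$ is $\dim\mathcal N(R(\mu))$, and its algebraic multiplicity is its multiplicity as a root of $\det R(\lambda)$. "Counting multiplicity" refers to algebraic multiplicity. A matrix $X\in\mathbb C^{n\times n}$ is $M$-unitary if $X^*MX=I_n$. The symbol $\widetilde P_0$ denotes the polynomial defined in (b), not $\widetilde P_t$ at $t=0$. *)

theory Defs
  imports
    Complex_Main
    "HOL-Computational_Algebra.Polynomial"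
    "Jordan_Normal_Form.Matrix_Kernel"
    "Jordan_Normal_Form.DL_Rank"
    "Jordan_Normal_Form.Schur_Decomposition"
begin

definition hermitian_mat :: "complex mat \<Rightarrow> bool" where
  "hermitian_mat A \<longleftrightarrow> square_mat A \<and> mat_adjoint A = A"

(* The product v \<bullet>c w conjugates its right argument, so (A *\<^sub>v v) \<bullet>c v is v* A v;
   it is real for Hermitian A, hence taking Re loses nothing. *)
definition pos_definite :: "complex mat \<Rightarrow> bool" where
  "pos_definite A \<longleftrightarrow> hermitian_mat A \<and>
     (\<forall>v \<in> carrier_vec (dim_row A). v \<noteq> 0\<^sub>v (dim_row A) \<longrightarrow> Re ((A *\<^sub>v v) \<bullet>c v) > 0)"

definition pos_semidefinite :: "complex mat \<Rightarrow> bool" where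
  "pos_semidefinite A \<longleftrightarrow> hermitian_mat A \<and>
     (\<forall>v \<in> carrier_vec (dim_row A). Re ((A *\<^sub>v v) \<bullet>c v) \<ge> 0)"

(* The block row [A B], for matrices with the same number of rows. *)
definition block_row :: "'a :: zero mat \<Rightarrow> 'a mat \<Rightarrow> 'a mat" where
  "block_row A B = four_block_mat A B (0\<^sub>m 0 (dim_col A)) (0\<^sub>m 0 (dim_col B))"

definition m_unitary :: "complex mat \<Rightarrow> complex mat \<Rightarrow> bool" where
  "m_unitary M X \<longleftrightarrow> X \<in> carrier_mat (dim_row M) (dim_row M) \<and>
     mat_adjoint X * M * X = 1\<^sub>m (dim_row M)"

(* Matrix polynomials are represented as matrices with polynomial entries. *)

definition const_pmat :: "complex mat \<Rightarrow> complex poly mat" where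
  "const_pmat A = map_mat (\<lambda>c. [:c:]) A"

definition eval_pmat :: "complex poly mat \<Rightarrow> complex \<Rightarrow> complex mat" where
  "eval_pmat R z = map_mat (\<lambda>q. poly q z) R"

definition pmat_spectrum :: "complex poly mat \<Rightarrow> complex set" where
  "pmat_spectrum R = {z. det (eval_pmat R z) = 0}"

definition geom_mult :: "complex poly mat \<Rightarrow> complex \<Rightarrow> nat" where
  "geom_mult R z = kernel_dim (eval_pmat R z)"

definition alg_mult :: "complex poly mat \<Rightarrow> complex \<Rightarrow> nat" where
  "alg_mult R z = order z (det R)"

(* X* R X for a constant matrix X *)
definition congr_pmat :: "complex mat \<Rightarrow> complex poly mat \<Rightarrow> complex poly mat" where
  "congr_pmat X R = const_pmat (mat_adjoint X) * R * const_pmat X"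

definition undamped_pmat :: "complex mat \<Rightarrow> complex mat \<Rightarrow> complex poly mat" where
  "undamped_pmat M K = monom 1 2 \<cdot>\<^sub>m const_pmat M + const_pmat K"

definition damped_pmat ::
    "complex mat \<Rightarrow> complex mat \<Rightarrow> complex mat \<Rightarrow> real \<Rightarrow> complex poly mat" where
  "damped_pmat M D K t =
     monom 1 2 \<cdot>\<^sub>m const_pmat M + monom (of_real t) 1 \<cdot>\<^sub>m const_pmat D + const_pmat K"

definition imag_axis :: "complex set" where
  "imag_axis = {z. Re z = 0}"

definition conj_pair :: "real \<Rightarrow> complex set" where
  "conj_pair \<omega> = {\<i> * of_real \<omega>, - (\<i> * of_real \<omega>)}"

definition oscillator_pmat :: "nat \<Rightarrow> (nat \<Rightarrow> real) \<Rightarrow> (nat \<Rightarrow> nat) \<Rightarrow> complex poly mat" where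
  "oscillator_pmat l \<omega> p =
     diag_block_mat (map (\<lambda>j. [:of_real ((\<omega> j)\<^sup>2), 0, 1:] \<cdot>\<^sub>m 1\<^sub>m (p j)) [1..<Suc l])"

lemma poly_det_eval_pmat: "poly (det R) z = det (eval_pmat R z)"
proof -
  have "comm_ring_hom (\<lambda>q. poly q z)"
    by unfold_locales auto
  from comm_ring_hom.hom_det[OF this] show ?thesis
    by (simp add: eval_pmat_def)
qed

lemma pos_definite_det_nonzero:
  assumes K: "K \<in> carrier_mat n n" and pd: "pos_definite K"
  shows "det K \<noteq> 0"
proof
  assume "det K = 0"
  then obtain v where v: "v \<in> carrier_vec n" "v \<noteq> 0\<^sub>v n" "K *\<^sub>v v = 0\<^sub>v n"
    using det_0_iff_vec_prod_zero[OF K] by blast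
  have "Re ((K *\<^sub>v v) \<bullet>c v) > 0"
    using pd K v(1,2) by (auto simp: pos_definite_def)
  moreover have "(K *\<^sub>v v) \<bullet>c v = 0"
    using v by simp
  ultimately show False by simp
qed

(* The determinants of both pencils do not vanish identically, so their spectra and
   algebraic multiplicities are meaningful. *)

lemma det_damped_pmat_nonzero:
  assumes "M \<in> carrier_mat n n" "D \<in> carrier_mat n n" "K \<in> carrier_mat n n" "pos_definite K"
  shows "det (damped_pmat M D K t) \<noteq> 0"
proof
  assume "det (damped_pmat M D K t) = 0"
  then have "det (eval_pmat (damped_pmat M D K t) 0) = 0"
    by (metis poly_0 poly_det_eval_pmat)
  moreover have "eval_pmat (damped_pmat M D K t) 0 = K"
    using assms(1-3)
    by (intro eq_matI) (auto simp: eval_pmat_def damped_pmat_def const_pmat_def poly_monom)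
  ultimately show False
    using pos_definite_det_nonzero[OF assms(3,4)] by simp
qed

lemma det_undamped_pmat_nonzero:
  assumes "M \<in> carrier_mat n n" "K \<in> carrier_mat n n" "pos_definite K"
  shows "det (undamped_pmat M K) \<noteq> 0"
proof
  assume "det (undamped_pmat M K) = 0"
  then have "det (eval_pmat (undamped_pmat M K) 0) = 0"
    by (metis poly_0 poly_det_eval_pmat)
  moreover have "eval_pmat (undamped_pmat M K) 0 = K"
    using assms(1-2)
    by (intro eq_matI) (auto simp: eval_pmat_def undamped_pmat_def const_pmat_def poly_monom)
  ultimately show False
    using pos_definite_det_nonzero[OF assms(2,3)] by simp
qed

end

theory Submission
  imports Defs
begin

text \<open>
  If \<open>P_t(z) v = 0\<close> with \<open>z\<close> purely imaginary, then the imaginary part of \<open>v* P_t(z) v = 0\<close> gives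
  \<open>v* D v = 0\<close>, hence \<open>D v = 0\<close>. So for \<open>z = \<plusminus> i \<omega>\<close> the nullspace of \<open>P_t(z)\<close> is the space of
  undamped modes \<open>{v. D v = 0, K v = \<omega>\<^sup>2 M v}\<close>, whatever \<open>t > 0\<close> is. On such a mode
  \<open>P_t(\<lambda>)\<close> acts as \<open>(\<lambda>\<^sup>2 + \<omega>\<^sup>2) M\<close>, so completing \<open>M\<close>-orthonormal modes to an \<open>M\<close>-unitary matrix
  \<open>[X_1 X_2]\<close> splits off the oscillators \<open>\<lambda>\<^sup>2 + \<omega>\<^sup>2\<close>, and what remains is nonsingular at \<open>\<plusminus> i \<omega>\<close>
  once all modes for \<open>\<omega>\<close> have been split off. Multiplicities and ranks are read off
  this block form; the statements on \<open>P_0\<close> are the case \<open>D = 0\<close>.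
\<close>

section \<open>Sesquilinear forms and orthonormal lists\<close>

text \<open>The rank, both multiplicities and the size of an oscillator block are tied to one
  number, the length of a complete M-orthonormal list of modes. Such a list is a longest one, so
  only normalising a single vector enters, not a diagonalisation of the pencil. The rank condition
  counts modes because \<open>z\<^sup>2\<close> is real on the imaginary axis: P_0(z) and D are then
  Hermitian, and for z nonzero the vectors orthogonal to the range of [P_0(z) D] are exactly the
  common null vectors of P_0(z) and D, that is, the modes. Frequencies are recorded through \<mu> =
  \<open>- z\<^sup>2\<close> instead of z. Both members of a pair \<plusminus> i \<omega> then share
  their modes, and \<mu> is real on the axis, so that modes for distinct parameters are M-orthogonal
  and all frequencies can be split off at once. Damped modes are also undamped modes. Extending a
  complete list of the former to one of the latter yields both the inclusion of spectra and p \<le>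
  m.\<close>

lemma eq_vec_if_diff_zero:
  fixes u v :: "'a :: group_add vec"
  assumes "u \<in> carrier_vec n" "v \<in> carrier_vec n" and z: "u - v = 0\<^sub>v n"
  shows "u = v"
proof (intro eq_vecI)
  fix i assume "i < dim_vec v"
  then show "u $ i = v $ i" using arg_cong[OF z, of "\<lambda>x. x $ i"] assms(1,2) by simp
qed (use assms in simp)

lemma smult_zero_vec_right: "c \<cdot>\<^sub>v 0\<^sub>v n = (0\<^sub>v n :: 'a :: mult_zero vec)"
  by (intro eq_vecI) auto

lemma zero_mat_mult_vec: "v \<in> carrier_vec nc \<Longrightarrow> 0\<^sub>m nr nc *\<^sub>v v = (0\<^sub>v nr :: 'a :: semiring_0 vec)"
  by (intro eq_vecI) auto

lemma mult_mat_zero_vec: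
  "A \<in> carrier_mat nr nc \<Longrightarrow> A *\<^sub>v 0\<^sub>v nc = 0\<^sub>v nr"
  by (intro eq_vecI) auto

text \<open>This is v* A u, linear in \<open>u\<close> and conjugate-linear in \<open>v\<close>. The
  test vector comes last, so that fixing it tests \<open>A *\<^sub>v u\<close>.\<close>

definition mform :: "complex mat \<Rightarrow> complex vec \<Rightarrow> complex vec \<Rightarrow> complex" where
  "mform A u v = (A *\<^sub>v u) \<bullet>c v"

lemma mat_adjoint_carrier [simp]:
  "A \<in> carrier_mat nr nc \<Longrightarrow> mat_adjoint A \<in> carrier_mat nc nr"
  unfolding mat_adjoint_def by (simp add: mat_of_rows_def)

lemma mat_adjoint_index:
  "i < dim_col A \<Longrightarrow> j < dim_row A \<Longrightarrow> mat_adjoint A $$ (i, j) = conjugate (A $$ (j, i))"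
  unfolding mat_adjoint_def by (simp add: mat_of_rows_def)

lemma mform_add_left:
  assumes "A \<in> carrier_mat n n" "u \<in> carrier_vec n" "u' \<in> carrier_vec n" "v \<in> carrier_vec n"
  shows "mform A (u + u') v = mform A u v + mform A u' v"
  unfolding mform_def using assms
  by (simp add: mult_add_distrib_mat_vec[of _ n n] add_scalar_prod_distrib[of _ n])

lemma mform_minus_left:
  assumes "A \<in> carrier_mat n n" "u \<in> carrier_vec n" "u' \<in> carrier_vec n" "v \<in> carrier_vec n"
  shows "mform A (u - u') v = mform A u v - mform A u' v"
  unfolding mform_def using assms
  by (simp add: mult_minus_distrib_mat_vec[of _ n n] minus_scalar_prod_distrib[of _ n])

lemma mform_zero_left:
  assumes "A \<in> carrier_mat n n" "v \<in> carrier_vec n"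
  shows "mform A (0\<^sub>v n) v = 0"
  using assms by (simp add: mform_def mult_mat_zero_vec[of A n n])

lemma mform_smult_left:
  assumes "A \<in> carrier_mat n n" "u \<in> carrier_vec n" "v \<in> carrier_vec n"
  shows "mform A (c \<cdot>\<^sub>v u) v = c * mform A u v"
  unfolding mform_def using assms by (simp add: mult_mat_vec[of _ n n])

lemma mform_smult_right:
  assumes "A \<in> carrier_mat n n" "u \<in> carrier_vec n" "v \<in> carrier_vec n"
  shows "mform A u (c \<cdot>\<^sub>v v) = cnj c * mform A u v"
  unfolding mform_def using assms by (simp add: conjugate_smult_vec)

lemma hermitian_mat_index:
  assumes "hermitian_mat A" "A \<in> carrier_mat n n" "i < n" "j < n"
  shows "A $$ (i, j) = cnj (A $$ (j, i))"
  using assms mat_adjoint_index[of i A j] by (auto simp: hermitian_mat_def)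

lemma mform_sum:
  assumes "A \<in> carrier_mat n n" "u \<in> carrier_vec n" "v \<in> carrier_vec n"
  shows "mform A u v = (\<Sum>i<n. \<Sum>j<n. A $$ (i, j) * u $ j * cnj (v $ i))"
  unfolding mform_def using assms
  by (auto simp: scalar_prod_def sum_distrib_right atLeast0LessThan intro!: sum.cong)

lemma mform_hermitian:
  assumes h: "hermitian_mat A" and A: "A \<in> carrier_mat n n"
    and u: "u \<in> carrier_vec n" and v: "v \<in> carrier_vec n"
  shows "mform A u v = cnj (mform A v u)"
proof -
  have "cnj (mform A v u) = (\<Sum>i<n. \<Sum>j<n. A $$ (j, i) * cnj (v $ j) * u $ i)"
    unfolding mform_sum[OF A v u]
    by (auto intro!: sum.cong simp: hermitian_mat_index[OF h A, symmetric])
  also have "\<dots> = (\<Sum>j<n. \<Sum>i<n. A $$ (j, i) * cnj (v $ j) * u $ i)"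
    by (rule sum.swap)
  also have "\<dots> = mform A u v"
    unfolding mform_sum[OF A u v] by (auto intro!: sum.cong)
  finally show ?thesis by simp
qed

lemma mform_self_real:
  assumes "hermitian_mat A" "A \<in> carrier_mat n n" "u \<in> carrier_vec n"
  shows "mform A u u = of_real (Re (mform A u u))"
  using mform_hermitian[OF assms assms(3)] by (metis Reals_cnj_iff complex_is_Real_iff of_real_Re)

text \<open>If w = D v were nonzero, moving from v a little in the direction - w would make the form
  negative: its first-order term is - 2 |w|^2, while its value at v is 0.\<close>

lemma pos_semidefinite_null:
  assumes D: "D \<in> carrier_mat n n" and psd: "pos_semidefinite D"
    and v: "v \<in> carrier_vec n" and z: "Re (mform D v v) = 0"
  shows "D *\<^sub>v v = 0\<^sub>v n"
proof (rule ccontr)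
  assume nz: "D *\<^sub>v v \<noteq> 0\<^sub>v n"
  have h: "hermitian_mat D" using psd by (simp add: pos_semidefinite_def)
  define w where "w = D *\<^sub>v v"
  have w: "w \<in> carrier_vec n" using D v by (simp add: w_def)
  define a where "a = Re (w \<bullet>c w)"
  have "w \<bullet>c w > 0" using nz w by (simp add: w_def)
  then have a: "a > 0" by (simp add: a_def less_complex_def)
  have vw: "Re (mform D v w) = a" by (simp add: a_def mform_def w_def)
  have wv: "Re (mform D w v) = a" using mform_hermitian[OF h D w v] vw by simp
  define b where "b = Re (mform D w w)"
  have ge: "0 \<le> Re (mform D u u)" if "u \<in> carrier_vec n" for u
    using psd that D by (auto simp: pos_semidefinite_def mform_def)
  have b: "b \<ge> 0" using ge[OF w] by (simp add: b_def)
  have key: "0 \<le> - 2 * s * a + s\<^sup>2 * b" for s :: real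
  proof -
    \<comment> \<open>A real scalar, so that it leaves the conjugated argument unchanged.\<close>
    let ?s = "complex_of_real (- s)"
    have sw: "?s \<cdot>\<^sub>v w \<in> carrier_vec n" using w by simp
    have hs: "mform D u (v + ?s \<cdot>\<^sub>v w) = mform D u v + ?s * mform D u w" if u: "u \<in> carrier_vec n" for u
      using mform_hermitian[OF h D u, of "v + ?s \<cdot>\<^sub>v w"] mform_hermitian[OF h D u v]
        mform_hermitian[OF h D u w] mform_add_left[OF D v sw u] mform_smult_left[OF D w u] v w by simp
    have "mform D (v + ?s \<cdot>\<^sub>v w) (v + ?s \<cdot>\<^sub>v w) =
        mform D v v + ?s * mform D w v + ?s * (mform D v w + ?s * mform D w w)"
      using v w sw by (simp only: hs mform_add_left[OF D] mform_smult_left[OF D] add_carrier_vec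
        distrib_left mult.assoc add.assoc add.left_commute)
    then have "Re (mform D (v + ?s \<cdot>\<^sub>v w) (v + ?s \<cdot>\<^sub>v w)) =
        Re (mform D v v + ?s * mform D w v + ?s * (mform D v w + ?s * mform D w w))"
      by (rule arg_cong)
    also have "\<dots> = - 2 * s * a + s\<^sup>2 * b"
      using z vw wv by (simp add: b_def power2_eq_square algebra_simps)
    finally show ?thesis using ge[of "v + ?s \<cdot>\<^sub>v w"] v w by simp
  qed
  \<comment> \<open>A value of s that is small enough: the denominator b + 1 covers b = 0 and gives
    q b \<le> a, hence q b - 2 a < 0.\<close>
  define q where "q = a / (b + 1)"
  have "q > 0" using a b by (simp add: q_def)
  moreover have "q * b \<le> a" using a b by (simp add: q_def field_simps)
  ultimately have "q * (q * b - 2 * a) < 0" using a by (intro mult_pos_neg) auto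
  then show False using key[of q] by (simp add: power2_eq_square algebra_simps)
qed

text \<open>Padding with zero rows makes the matrix square and singular, and its null vectors are
  those of \<open>A\<close>.\<close>

lemma exists_wide_kernel_vec:
  fixes A :: "'a :: field mat"
  assumes A: "A \<in> carrier_mat nr nc" and lt: "nr < nc"
  shows "\<exists>v \<in> carrier_vec nc. v \<noteq> 0\<^sub>v nc \<and> A *\<^sub>v v = 0\<^sub>v nr"
proof -
  define B where "B = mat nc nc (\<lambda>(i, j). if i < nr then A $$ (i, j) else 0)"
  have B: "B \<in> carrier_mat nc nc" by (simp add: B_def)
  \<comment> \<open>Row \<open>nr\<close> of \<open>B\<close> is the first padding row; it exists
    because nr < nc.\<close>
  have "transpose_mat B *\<^sub>v unit_vec nc nr = 0\<^sub>v nc"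
    using lt by (intro eq_vecI) (auto simp: B_def)
  moreover have "unit_vec nc nr \<noteq> (0\<^sub>v nc :: 'a vec)" using lt by simp
  ultimately have "det (transpose_mat B) = 0"
    by (subst det_0_iff_vec_prod_zero_field[of "transpose_mat B" nc])
      (use B in \<open>auto intro!: exI[of _ "unit_vec nc nr"]\<close>)
  then have "det B = 0" using det_transpose[OF B] by simp
  then obtain v where v: "v \<in> carrier_vec nc" "v \<noteq> 0\<^sub>v nc" "B *\<^sub>v v = 0\<^sub>v nc"
    using det_0_iff_vec_prod_zero_field[OF B] by blast
  have "A *\<^sub>v v = 0\<^sub>v nr"
  proof (intro eq_vecI)
    fix i assume "i < dim_vec (0\<^sub>v nr)"
    then have i: "i < nr" by simp
    have "row A i = row B i" using i lt A by (intro eq_vecI) (auto simp: B_def)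
    moreover have "(B *\<^sub>v v) $ i = 0" using v i lt by simp
    ultimately show "(A *\<^sub>v v) $ i = 0\<^sub>v nr $ i" using i lt A B by simp
  qed (use A in simp)
  with v show ?thesis by blast
qed

lemma mat_adjoint_mat_of_cols_mult_vec:
  assumes "set vs \<subseteq> carrier_vec n" "g \<in> carrier_vec n"
  shows "mat_adjoint (mat_of_cols n vs) *\<^sub>v g = vec (length vs) (\<lambda>k. g \<bullet>c (vs ! k))"
proof (intro eq_vecI)
  fix k assume "k < dim_vec (vec (length vs) (\<lambda>k. g \<bullet>c (vs ! k)))"
  then have k: "k < length vs" by simp
  then have "vs ! k \<in> carrier_vec n" using assms nth_mem by blast
  then show "(mat_adjoint (mat_of_cols n vs) *\<^sub>v g) $ k = vec (length vs) (\<lambda>k. g \<bullet>c (vs ! k)) $ k"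
    using k assms
    by (auto simp: scalar_prod_def mat_adjoint_def mat_of_rows_def intro!: sum.cong)
qed (simp add: mat_adjoint_def)

lemma gram_mat:
  assumes us: "set us \<subseteq> carrier_vec n" and vs: "set vs \<subseteq> carrier_vec n" and A: "A \<in> carrier_mat n n"
  shows "mat_adjoint (mat_of_cols n us) * A * mat_of_cols n vs =
    mat (length us) (length vs) (\<lambda>(i, j). mform A (vs ! j) (us ! i))"
proof (intro eq_matI, goal_cases)
  case (1 i j)
  then have i: "i < length us" and j: "j < length vs" by auto
  have vj: "vs ! j \<in> carrier_vec n" using j vs nth_mem by blast
  have X: "mat_adjoint (mat_of_cols n us) \<in> carrier_mat (length us) n" by simp
  have "(mat_adjoint (mat_of_cols n us) * A * mat_of_cols n vs) $$ (i, j) =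
     col (mat_adjoint (mat_of_cols n us) * A * mat_of_cols n vs) j $ i"
    using i j A by (simp add: mat_adjoint_def)
  also have "\<dots> = (mat_adjoint (mat_of_cols n us) * A *\<^sub>v vs ! j) $ i"
    using col_mult2[OF mult_carrier_mat[OF X A] mat_of_cols_carrier(1) j] col_mat_of_cols[OF j vj]
    by (simp only:)
  also have "\<dots> = (mat_adjoint (mat_of_cols n us) *\<^sub>v (A *\<^sub>v vs ! j)) $ i"
    using assoc_mult_mat_vec[OF X A vj] by simp
  also have "\<dots> = mform A (vs ! j) (us ! i)"
    using mat_adjoint_mat_of_cols_mult_vec[OF us, of "A *\<^sub>v vs ! j"] A vj i by (simp add: mform_def)
  finally show ?case using i j by simp
qed (simp_all add: mat_adjoint_def)

section \<open>Orthonormal lists: coordinates, length bound and completion\<close>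

definition orthonormal_list :: "complex mat \<Rightarrow> complex vec list \<Rightarrow> bool" where
  "orthonormal_list M vs \<longleftrightarrow> set vs \<subseteq> carrier_vec (dim_row M) \<and>
     (\<forall>i < length vs. \<forall>j < length vs. mform M (vs ! i) (vs ! j) = (if i = j then 1 else 0))"

lemma orthonormal_list_carrier:
  "orthonormal_list M vs \<Longrightarrow> M \<in> carrier_mat n n \<Longrightarrow> set vs \<subseteq> carrier_vec n"
  by (auto simp: orthonormal_list_def)

lemma orthonormal_list_gram:
  assumes "M \<in> carrier_mat n n" "orthonormal_list M vs"
  shows "mat_adjoint (mat_of_cols n vs) * M * mat_of_cols n vs = 1\<^sub>m (length vs)"
  using assms by (subst gram_mat) (auto simp: orthonormal_list_def)

lemma gram_mat_mult_vec:
  assumes us: "set us \<subseteq> carrier_vec n" and vs: "set vs \<subseteq> carrier_vec n" and A: "A \<in> carrier_mat n n"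
    and y: "y \<in> carrier_vec (length vs)"
  shows "mat_adjoint (mat_of_cols n us) * A * mat_of_cols n vs *\<^sub>v y =
    vec (length us) (\<lambda>i. mform A (mat_of_cols n vs *\<^sub>v y) (us ! i))"
proof -
  let ?U = "mat_adjoint (mat_of_cols n us)" and ?V = "mat_of_cols n vs"
  have U: "?U \<in> carrier_mat (length us) n" by simp
  have Vy: "?V *\<^sub>v y \<in> carrier_vec n" using mult_mat_vec_carrier[OF mat_of_cols_carrier(1) y] .
  have "?U * A * ?V *\<^sub>v y = ?U *\<^sub>v (A *\<^sub>v (?V *\<^sub>v y))"
    using assoc_mult_mat_vec[OF mult_carrier_mat[OF U A] mat_of_cols_carrier(1) y]
      assoc_mult_mat_vec[OF U A Vy] by simp
  then show ?thesis
    using mat_adjoint_mat_of_cols_mult_vec[OF us mult_mat_vec_carrier[OF A Vy]] by (simp add: mform_def)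
qed

lemma mform_mat_of_cols_mult_vec:
  assumes u: "u \<in> carrier_vec n" and vs: "set vs \<subseteq> carrier_vec n" and A: "A \<in> carrier_mat n n"
    and y: "y \<in> carrier_vec (length vs)"
  shows "mform A (mat_of_cols n vs *\<^sub>v y) u = (\<Sum>k<length vs. mform A (vs ! k) u * y $ k)"
proof -
  \<comment> \<open>The expansion is the single row of the Gram matrix for the one-element list
    [u].\<close>
  have us: "set [u] \<subseteq> carrier_vec n" using u by simp
  have "mform A (mat_of_cols n vs *\<^sub>v y) u =
      (mat_adjoint (mat_of_cols n [u]) * A * mat_of_cols n vs *\<^sub>v y) $ 0"
    unfolding gram_mat_mult_vec[OF us vs A y] by simp
  also have "\<dots> = (\<Sum>k<length vs. mform A (vs ! k) u * y $ k)"
    unfolding gram_mat[OF us vs A] using y by (simp add: scalar_prod_def atLeast0LessThan)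
  finally show ?thesis .
qed

lemma orthonormal_list_coords:
  assumes M: "M \<in> carrier_mat n n" and o: "orthonormal_list M vs" and w: "w \<in> carrier_vec (length vs)"
    and k: "k < length vs"
  shows "mform M (mat_of_cols n vs *\<^sub>v w) (vs ! k) = w $ k"
proof -
  have vs: "set vs \<subseteq> carrier_vec n" using orthonormal_list_carrier[OF o M] .
  show ?thesis
    using gram_mat_mult_vec[OF vs vs M w] orthonormal_list_gram[OF M o] k w
    by (metis index_vec one_mult_mat_vec)
qed

lemma orthonormal_list_inj:
  assumes M: "M \<in> carrier_mat n n" and o: "orthonormal_list M vs" and w: "w \<in> carrier_vec (length vs)"
    and z: "mat_of_cols n vs *\<^sub>v w = 0\<^sub>v n"
  shows "w = 0\<^sub>v (length vs)"
proof (intro eq_vecI)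
  fix k assume "k < dim_vec (0\<^sub>v (length vs))"
  then have k: "k < length vs" by simp
  then have "vs ! k \<in> carrier_vec n" using orthonormal_list_carrier[OF o M] nth_mem by blast
  then have "mform M (0\<^sub>v n) (vs ! k) = 0" using M by (rule mform_zero_left[rotated])
  then show "w $ k = 0\<^sub>v (length vs) $ k" using orthonormal_list_coords[OF M o w k] z k by simp
qed (use w in simp)

text \<open>A longer list would form a matrix with more columns than rows, hence have a nontrivial
  relation. The bound is what allows a longest list to be chosen below.\<close>

lemma orthonormal_list_length:
  assumes M: "M \<in> carrier_mat n n" and o: "orthonormal_list M vs"
  shows "length vs \<le> n"
proof (rule ccontr)
  assume "\<not> ?thesis"
  then have "n < length vs" by simp
  then obtain w where "w \<in> carrier_vec (length vs)" "w \<noteq> 0\<^sub>v (length vs)" "mat_of_cols n vs *\<^sub>v w = 0\<^sub>v n"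
    using exists_wide_kernel_vec[of "mat_of_cols n vs" n "length vs"] by auto
  then show False using orthonormal_list_inj[OF M o] by blast
qed

lemma orthonormal_list_distinct:
  assumes o: "orthonormal_list M vs"
  shows "distinct vs"
  unfolding distinct_conv_nth
  using o unfolding orthonormal_list_def by (metis zero_neq_one)

lemma orthonormal_list_append:
  assumes M: "M \<in> carrier_mat n n" and h: "hermitian_mat M"
  shows "orthonormal_list M (vs @ us) \<longleftrightarrow> orthonormal_list M vs \<and> orthonormal_list M us \<and>
     (\<forall>v \<in> set vs. \<forall>u \<in> set us. mform M v u = 0)"
proof
  assume *: "orthonormal_list M (vs @ us)"
  then have c: "set vs \<subseteq> carrier_vec n" "set us \<subseteq> carrier_vec n" 
    using orthonormal_list_carrier[OF * M] by auto
  have **: "mform M ((vs @ us) ! i) ((vs @ us) ! j) = (if i = j then 1 else 0)"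
    if "i < length vs + length us" "j < length vs + length us" for i j
    using * that by (simp add: orthonormal_list_def)
  have "orthonormal_list M vs"
    unfolding orthonormal_list_def
  proof (intro conjI allI impI)
    fix i j assume "i < length vs" "j < length vs"
    then show "mform M (vs ! i) (vs ! j) = (if i = j then 1 else 0)"
      using **[of i j] by (simp add: nth_append)
  qed (use c M in auto)
  moreover have "orthonormal_list M us"
    unfolding orthonormal_list_def
  proof (intro conjI allI impI)
    fix i j assume "i < length us" "j < length us"
    then show "mform M (us ! i) (us ! j) = (if i = j then 1 else 0)"
      using **[of "length vs + i" "length vs + j"] by simp
  qed (use c M in auto)
  moreover have "mform M v u = 0" if v: "v \<in> set vs" and u: "u \<in> set us" for v u
  proof -
    obtain i where i: "i < length vs" "v = vs ! i" using v by (metis in_set_conv_nth)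
    obtain j where j: "j < length us" "u = us ! j" using u by (metis in_set_conv_nth)
    show ?thesis using **[of i "length vs + j"] i j by (simp add: nth_append)
  qed
  ultimately show "orthonormal_list M vs \<and> orthonormal_list M us \<and>
     (\<forall>v \<in> set vs. \<forall>u \<in> set us. mform M v u = 0)" by blast
next
  assume *: "orthonormal_list M vs \<and> orthonormal_list M us \<and>
     (\<forall>v \<in> set vs. \<forall>u \<in> set us. mform M v u = 0)"
  then have c: "set vs \<subseteq> carrier_vec n" "set us \<subseteq> carrier_vec n" 
    using orthonormal_list_carrier M by blast+
  have "mform M ((vs @ us) ! i) ((vs @ us) ! j) = (if i = j then 1 else 0)"
    if ij: "i < length vs + length us" "j < length vs + length us" for i j
  proof -
    have z: "mform M v u = 0" "mform M u v = 0" if "v \<in> set vs" "u \<in> set us" for u v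
      using * that mform_hermitian[OF h M, of u v] c by auto
    show ?thesis
      using * ij z by (auto simp: nth_append orthonormal_list_def)
  qed
  then show "orthonormal_list M (vs @ us)"
    using c M by (auto simp: orthonormal_list_def)
qed

lemma orthonormal_list_snoc_normalized:
  assumes M: "M \<in> carrier_mat n n" and pd: "pos_definite M" and o: "orthonormal_list M vs"
    and u: "u \<in> carrier_vec n" "u \<noteq> 0\<^sub>v n" and orth: "\<forall>v \<in> set vs. mform M u v = 0"
  shows "\<exists>c. orthonormal_list M (vs @ [c \<cdot>\<^sub>v u])"
proof -
  have h: "hermitian_mat M" using pd by (simp add: pos_definite_def)
  define r where "r = Re (mform M u u)"
  have r: "r > 0" using pd u M by (simp add: r_def pos_definite_def mform_def)
  have mr: "mform M u u = of_real r" using mform_self_real[OF h M u(1)] by (simp add: r_def)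
  define c where "c = complex_of_real (1 / sqrt r)"
  have "mform M (c \<cdot>\<^sub>v u) (c \<cdot>\<^sub>v u) = c * c * of_real r"
    using u(1) mr by (simp add: mform_smult_left[OF M] mform_smult_right[OF M] c_def)
  also have "\<dots> = of_real (1 / sqrt r * (1 / sqrt r) * r)"
    by (simp only: c_def of_real_mult)
  also have "1 / sqrt r * (1 / sqrt r) * r = 1" using r by simp
  finally have cc: "mform M (c \<cdot>\<^sub>v u) (c \<cdot>\<^sub>v u) = 1" by simp
  have "orthonormal_list M [c \<cdot>\<^sub>v u]"
    using M u(1) cc by (simp add: orthonormal_list_def)
  moreover have "mform M v (c \<cdot>\<^sub>v u) = 0" if v: "v \<in> set vs" for v
  proof -
    have vc: "v \<in> carrier_vec n" using v orthonormal_list_carrier[OF o M] by blast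
    then have "mform M (c \<cdot>\<^sub>v u) v = 0" using orth v u(1) by (simp add: mform_smult_left[OF M])
    then show ?thesis using mform_hermitian[OF h M vc, of "c \<cdot>\<^sub>v u"] u(1) by simp
  qed
  ultimately show ?thesis using orthonormal_list_append[OF M h] o by auto
qed

text \<open>Take an extension inside \<open>S\<close> of maximal length. A nonzero vector of
  \<open>S\<close> orthogonal to all of it could be normalised, which stays in \<open>S\<close>, and
  appended.\<close>

lemma orthonormal_list_extend:
  assumes M: "M \<in> carrier_mat n n" and pd: "pos_definite M" and o: "orthonormal_list M us"
    and us: "set us \<subseteq> S" and S: "S \<subseteq> carrier_vec n"
    and smult: "\<And>c v. v \<in> S \<Longrightarrow> c \<cdot>\<^sub>v v \<in> S"
  shows "\<exists>ws. orthonormal_list M (us @ ws) \<and> set ws \<subseteq> S \<and>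
           (\<forall>u \<in> S. (\<forall>v \<in> set (us @ ws). mform M u v = 0) \<longrightarrow> u = 0\<^sub>v n)"
proof -
  let ?P = "\<lambda>k. \<exists>ws. orthonormal_list M (us @ ws) \<and> set ws \<subseteq> S \<and> length ws = k"
  have "?P 0" using o by simp
  moreover have bound: "k \<le> n" if "?P k" for k
    using that orthonormal_list_length[OF M] by fastforce
  ultimately obtain k where k: "?P k" and max: "\<And>k'. ?P k' \<Longrightarrow> k' \<le> k"
    using GreatestI_nat[of ?P 0 n] Greatest_le_nat[of ?P _ n] by blast
  then obtain ws where ws: "orthonormal_list M (us @ ws)" "set ws \<subseteq> S" "length ws = k" by blast
  have "u = 0\<^sub>v n" if u: "u \<in> S" and uo: "\<forall>v \<in> set (us @ ws). mform M u v = 0" for u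
  proof (rule ccontr)
    assume nz: "u \<noteq> 0\<^sub>v n"
    have uc: "u \<in> carrier_vec n" using u S by blast
    obtain c where "orthonormal_list M ((us @ ws) @ [c \<cdot>\<^sub>v u])"
      using orthonormal_list_snoc_normalized[OF M pd ws(1) uc nz uo] by blast
    then have "?P (Suc k)" using ws smult[OF u] by (intro exI[of _ "ws @ [c \<cdot>\<^sub>v u]"]) auto
    then show False using max by fastforce
  qed
  then show ?thesis using ws by blast
qed

lemma mat_of_cols_mult_vec_kernel:
  fixes B :: "'a :: field mat"
  assumes B: "B \<in> carrier_mat nr n" and vs: "set vs \<subseteq> mat_kernel B" and w: "w \<in> carrier_vec (length vs)"
  shows "mat_of_cols n vs *\<^sub>v w \<in> mat_kernel B"
proof -
  have vc: "set vs \<subseteq> carrier_vec n" using vs mat_kernel_carrier[OF B] by blast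
  have "B * mat_of_cols n vs = 0\<^sub>m nr (length vs)"
  proof (intro eq_matI)
    fix i j assume "i < dim_row (0\<^sub>m nr (length vs))" "j < dim_col (0\<^sub>m nr (length vs))"
    then have i: "i < nr" and j: "j < length vs" by auto
    have "B *\<^sub>v vs ! j = 0\<^sub>v nr" using mat_kernelD[OF B] vs j nth_mem by blast
    then have "(B *\<^sub>v vs ! j) $ i = 0" using i by simp
    moreover have "vs ! j \<in> carrier_vec n" using vc j nth_mem by blast
    ultimately show "(B * mat_of_cols n vs) $$ (i, j) = 0\<^sub>m nr (length vs) $$ (i, j)"
      using i j B by simp
  qed (use B in auto)
  then have "B *\<^sub>v (mat_of_cols n vs *\<^sub>v w) = 0\<^sub>m nr (length vs) *\<^sub>v w"
    using assoc_mult_mat_vec[OF B mat_of_cols_carrier(1) w] by simp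
  also have "\<dots> = 0\<^sub>v nr" by (rule zero_mat_mult_vec[OF w])
  finally show ?thesis using mat_kernelI[OF B] mult_mat_vec_carrier[OF mat_of_cols_carrier(1) w] by blast
qed

text \<open>The difference of \<open>u\<close> and its M-orthogonal projection lies in the kernel
  and is orthogonal to the list, so completeness makes it vanish.\<close>

lemma complete_orthonormal_list_expansion:
  assumes M: "M \<in> carrier_mat n n" and o: "orthonormal_list M vs"
    and B: "B \<in> carrier_mat nr n" and vs: "set vs \<subseteq> mat_kernel B"
    and complete: "\<forall>u \<in> mat_kernel B. (\<forall>v \<in> set vs. mform M u v = 0) \<longrightarrow> u = 0\<^sub>v n"
    and u: "u \<in> mat_kernel B"
  shows "u = mat_of_cols n vs *\<^sub>v vec (length vs) (\<lambda>k. mform M u (vs ! k))"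
proof -
  let ?w = "vec (length vs) (\<lambda>k. mform M u (vs ! k))"
  let ?p = "mat_of_cols n vs *\<^sub>v ?w"
  have uc: "u \<in> carrier_vec n" using u mat_kernelD[OF B] by blast
  have pk: "?p \<in> mat_kernel B" using mat_of_cols_mult_vec_kernel[OF B vs] by simp
  then have pc: "?p \<in> carrier_vec n" using mat_kernelD[OF B] by blast
  have "u - ?p \<in> mat_kernel B"
  proof (rule mat_kernelI[OF B])
    show "u - ?p \<in> carrier_vec n" using uc pc by simp
    show "B *\<^sub>v (u - ?p) = 0\<^sub>v nr"
      using mult_minus_distrib_mat_vec[OF B uc pc] mat_kernelD(2)[OF B u] mat_kernelD(2)[OF B pk] by simp
  qed
  moreover have "mform M (u - ?p) v = 0" if "v \<in> set vs" for v
  proof -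
    obtain k where k: "k < length vs" "v = vs ! k" using \<open>v \<in> set vs\<close> by (metis in_set_conv_nth)
    have "v \<in> carrier_vec n" using that orthonormal_list_carrier[OF o M] by blast
    then show ?thesis
      using orthonormal_list_coords[OF M o _ k(1), of ?w] k by (simp add: mform_minus_left[OF M uc pc])
  qed
  ultimately have "u - ?p = 0\<^sub>v n" using complete by blast
  then show ?thesis by (rule eq_vec_if_diff_zero[OF uc pc])
qed

section \<open>Kernel dimension and rank expressed through columns\<close>

lemma (in vec_space) span_set_eq_range:
  assumes us: "set us \<subseteq> carrier_vec n"
  shows "span (set us) = (\<lambda>w. mat_of_cols n us *\<^sub>v w) ` carrier_vec (length us)"
proof -
  have *: "\<forall>w \<in> set us. dim_vec w = n" using us by auto
  have "span (set us) = span_list us" using span_list_as_span[OF us] by simp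
  also have "\<dots> = {lincomb_list c us | c. True}" by (auto simp: span_list_def)
  also have "\<dots> = {mat_of_cols n us *\<^sub>v vec (length us) c | c. True}"
    using lincomb_list_as_mat_mult[OF *] by simp
  also have "\<dots> = (\<lambda>w. mat_of_cols n us *\<^sub>v w) ` carrier_vec (length us)"
  proof (intro equalityI subsetI)
    fix x assume "x \<in> (\<lambda>w. mat_of_cols n us *\<^sub>v w) ` carrier_vec (length us)"
    then obtain w where w: "w \<in> carrier_vec (length us)" "x = mat_of_cols n us *\<^sub>v w" by blast
    have "mat_of_cols n us *\<^sub>v w = mat_of_cols n us *\<^sub>v vec (length us) (\<lambda>i. w $ i)"
      using w(1) by (intro arg_cong[of _ _ "(*\<^sub>v) _"]) auto
    then show "x \<in> {mat_of_cols n us *\<^sub>v vec (length us) c | c. True}" unfolding w(2) by blast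
  qed auto
  finally show ?thesis .
qed

lemma (in vec_space) lin_indpt_mat_of_cols:
  assumes us: "set us \<subseteq> carrier_vec n" and d: "distinct us"
    and inj: "\<And>w. w \<in> carrier_vec (length us) \<Longrightarrow> mat_of_cols n us *\<^sub>v w = 0\<^sub>v n \<Longrightarrow> w = 0\<^sub>v (length us)"
  shows "lin_indpt (set us)"
  using lin_depE[of "mat_of_cols n us" "length us"] us d inj cols_mat_of_cols[OF us]
  by (metis mat_of_cols_carrier(1))

text \<open>Independence and spanning are established in the ambient space, where they are
  statements on \<open>mat_of_cols\<close>, and then carried over to the kernel as a space of its
  own.\<close>

lemma kernel_dim_eq_length:
  fixes B :: "'a :: field mat"
  assumes B: "B \<in> carrier_mat nr n" and vs: "set vs \<subseteq> mat_kernel B" and d: "distinct vs"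
    and inj: "\<And>w. w \<in> carrier_vec (length vs) \<Longrightarrow> mat_of_cols n vs *\<^sub>v w = 0\<^sub>v n \<Longrightarrow> w = 0\<^sub>v (length vs)"
    and spanning: "\<And>u. u \<in> mat_kernel B \<Longrightarrow> \<exists>w \<in> carrier_vec (length vs). u = mat_of_cols n vs *\<^sub>v w"
  shows "kernel_dim B = length vs"
proof -
  interpret kernel nr n B by unfold_locales (rule B)
  have vc: "set vs \<subseteq> carrier_vec n" using vs mat_kernel_carrier[OF B] by blast
  have "\<not> NC.lin_dep (set vs)" by (rule NC.lin_indpt_mat_of_cols[OF vc d inj])
  then have ind: "lin_indpt (set vs)" using lindep_same[OF vs] by simp
  have "mat_kernel B \<subseteq> NC.span (set vs)"
    using spanning NC.span_set_eq_range[OF vc] by blast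
  then have "mat_kernel B \<subseteq> span (set vs)" using span_same[OF vs] by simp
  then have "gen_set (set vs)" using Ker.span_is_subset2 vs by auto
  then have "basis (set vs)" using ind vs by (auto simp: Ker.basis_def)
  then have "dim = card (set vs)" by (rule Ker.dim_basis[rotated]) simp
  then show ?thesis using d by (simp add: distinct_card)
qed

text \<open>The rank depends only on the span of the columns, so \<open>B\<close> may be replaced by
  any matrix with the same range.\<close>

lemma (in vec_space) rank_eq_length:
  assumes B: "B \<in> carrier_mat n nc" and us: "set us \<subseteq> carrier_vec n" and d: "distinct us"
    and inj: "\<And>w. w \<in> carrier_vec (length us) \<Longrightarrow> mat_of_cols n us *\<^sub>v w = 0\<^sub>v n \<Longrightarrow> w = 0\<^sub>v (length us)"
    and range: "(\<lambda>w. B *\<^sub>v w) ` carrier_vec nc = (\<lambda>w. mat_of_cols n us *\<^sub>v w) ` carrier_vec (length us)"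
  shows "rank B = length us"
proof -
  have "set (cols B) \<subseteq> carrier_vec n" using B cols_dim by blast
  from span_set_eq_range[OF this] mat_of_cols_cols[of B]
  have "span (set (cols B)) = span (set (cols (mat_of_cols n us)))"
    using B range by (simp add: span_set_eq_range[OF us] cols_mat_of_cols[OF us])
  then have "rank B = rank (mat_of_cols n us)" by (simp add: rank_def)
  also have "\<dots> = length us"
    using lin_indpt_full_rank[of "mat_of_cols n us" "length us"] us d lin_indpt_mat_of_cols[OF us d inj]
    by simp
  finally show ?thesis .
qed

text \<open>With fewer than n vectors, X* M would be wide, and a null vector of it is orthogonal to
  the whole list.\<close>

lemma orthonormal_list_length_eqI:
  assumes M: "M \<in> carrier_mat n n" and o: "orthonormal_list M vs"
    and complete: "\<forall>u \<in> carrier_vec n. (\<forall>v \<in> set vs. mform M u v = 0) \<longrightarrow> u = 0\<^sub>v n"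
  shows "length vs = n"
proof (rule ccontr)
  assume "length vs \<noteq> n"
  then have lt: "length vs < n" using orthonormal_list_length[OF M o] by simp
  have vs: "set vs \<subseteq> carrier_vec n" using orthonormal_list_carrier[OF o M] .
  let ?U = "mat_adjoint (mat_of_cols n vs)"
  have U: "?U \<in> carrier_mat (length vs) n" by simp
  obtain u where u: "u \<in> carrier_vec n" "u \<noteq> 0\<^sub>v n" "?U * M *\<^sub>v u = 0\<^sub>v (length vs)"
    using exists_wide_kernel_vec[OF mult_carrier_mat[OF U M] lt] by blast
  have "vec (length vs) (\<lambda>k. mform M u (vs ! k)) = 0\<^sub>v (length vs)"
    using mat_adjoint_mat_of_cols_mult_vec[OF vs mult_mat_vec_carrier[OF M u(1)]]
      assoc_mult_mat_vec[OF U M u(1)] u(3) by (simp add: mform_def)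
  then have "mform M u (vs ! k) = 0" if "k < length vs" for k
    using that by (metis index_vec index_zero_vec(1))
  then show False using complete u(1,2) by (metis in_set_conv_nth)
qed

lemma orthonormal_list_complement:
  assumes M: "M \<in> carrier_mat n n" and pd: "pos_definite M" and o: "orthonormal_list M us"
  shows "\<exists>ws. orthonormal_list M (ws @ us) \<and> length ws + length us = n"
proof -
  have h: "hermitian_mat M" using pd by (simp add: pos_definite_def)
  obtain ws where ws: "orthonormal_list M (us @ ws)"
      "\<forall>u \<in> carrier_vec n. (\<forall>v \<in> set (us @ ws). mform M u v = 0) \<longrightarrow> u = 0\<^sub>v n"
    using orthonormal_list_extend[OF M pd o orthonormal_list_carrier[OF o M]] by auto
  have "length (us @ ws) = n" by (rule orthonormal_list_length_eqI[OF M ws])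
  \<comment> \<open>The new vectors are moved to the front because the modes \<open>us\<close> have
    to become the last block of [X_1 X_2].\<close>
  moreover have "orthonormal_list M (ws @ us)"
  proof -
    have *: "orthonormal_list M us" "orthonormal_list M ws" "\<forall>u\<in>set us. \<forall>w\<in>set ws. mform M u w = 0"
      using ws(1) orthonormal_list_append[OF M h] by auto
    have "mform M w u = 0" if "w \<in> set ws" "u \<in> set us" for w u
      using mform_hermitian[OF h M, of w u] * that orthonormal_list_carrier[OF _ M] by (metis complex_cnj_zero subsetD)
    then show ?thesis using * orthonormal_list_append[OF M h] by blast
  qed
  ultimately show ?thesis by (intro exI[of _ ws]) simp
qed

text \<open>For a square X, X* M X = I implies M X X* = I, so X* g = 0 forces g = 0. The pairing
  carries no M, since the lemma is applied to residuals of linear equations.\<close>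

lemma orthonormal_basis_zeroI:
  assumes M: "M \<in> carrier_mat n n" and o: "orthonormal_list M vs" and len: "length vs = n"
    and g: "g \<in> carrier_vec n" and z: "\<And>v. v \<in> set vs \<Longrightarrow> g \<bullet>c v = 0"
  shows "g = 0\<^sub>v n"
proof -
  let ?X = "mat_of_cols n vs" and ?U = "mat_adjoint (mat_of_cols n vs)"
  have X: "?X \<in> carrier_mat n n" "?U \<in> carrier_mat n n" 
    using len mat_of_cols_carrier(1)[of n vs] by auto
  have vs: "set vs \<subseteq> carrier_vec n" using orthonormal_list_carrier[OF o M] .
  have "?U * (M * ?X) = 1\<^sub>m n" using orthonormal_list_gram[OF M o] len X M by simp
  then have inv: "(M * ?X) * ?U = 1\<^sub>m n"
    using mat_mult_left_right_inverse[OF X(2) mult_carrier_mat[OF M X(1)]] by blast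
  have "?U *\<^sub>v g = 0\<^sub>v n"
    using mat_adjoint_mat_of_cols_mult_vec[OF vs g] z len by (auto intro!: eq_vecI)
  then have "(M * ?X) *\<^sub>v (?U *\<^sub>v g) = 0\<^sub>v n"
    by (simp only: mult_mat_zero_vec[OF mult_carrier_mat[OF M X(1)]])
  then show ?thesis
    using assoc_mult_mat_vec[OF mult_carrier_mat[OF M X(1)] X(2) g] inv g by simp
qed

lemma mat_of_cols_append: "mat_of_cols n (ws @ us) = block_row (mat_of_cols n ws) (mat_of_cols n us)"
  by (intro eq_matI) (auto simp: block_row_def mat_of_cols_index nth_append)

lemma block_row_mult_vec:
  assumes A: "A \<in> carrier_mat n m" and B: "B \<in> carrier_mat n k"
    and x: "x \<in> carrier_vec m" and y: "y \<in> carrier_vec k"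
  shows "block_row A B *\<^sub>v (x @\<^sub>v y) = A *\<^sub>v x + B *\<^sub>v y"
  unfolding block_row_def
  using four_block_mat_mult_vec[OF A B _ _ x y, of "0\<^sub>m 0 m" 0 "0\<^sub>m 0 k"] assms
  by (auto intro!: eq_vecI)

section \<open>Congruence of matrix polynomials\<close>

lemma const_pmat_carrier [simp]: "A \<in> carrier_mat nr nc \<Longrightarrow> const_pmat A \<in> carrier_mat nr nc"
  by (simp add: const_pmat_def)

lemma const_pmat_mult:
  assumes "A \<in> carrier_mat nr n" "B \<in> carrier_mat n nc"
  shows "const_pmat (A * B) = const_pmat A * const_pmat B"
proof -
  have "semiring_hom (\<lambda>c :: complex. [:c:])"
    by unfold_locales (auto simp: one_pCons)
  from semiring_hom.mat_hom_mult[OF this assms] show ?thesis by (simp add: const_pmat_def)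
qed

lemma eval_pmat_mult:
  assumes "R \<in> carrier_mat nr n" "S \<in> carrier_mat n nc"
  shows "eval_pmat (R * S) z = eval_pmat R z * eval_pmat S z"
proof -
  have "semiring_hom (\<lambda>q :: complex poly. poly q z)"
    by unfold_locales auto
  from semiring_hom.mat_hom_mult[OF this assms] show ?thesis by (simp add: eval_pmat_def)
qed

lemma eval_const_pmat [simp]: "eval_pmat (const_pmat A) z = A"
  by (intro eq_matI) (auto simp: eval_pmat_def const_pmat_def)

lemma eval_pmat_carrier [simp]: "R \<in> carrier_mat nr nc \<Longrightarrow> eval_pmat R z \<in> carrier_mat nr nc"
  by (simp add: eval_pmat_def)

lemma eval_congr_pmat:
  assumes "R \<in> carrier_mat n n" "X \<in> carrier_mat n m"
  shows "eval_pmat (congr_pmat X R) z = mat_adjoint X * eval_pmat R z * X"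
proof -
  have c: "const_pmat (mat_adjoint X) \<in> carrier_mat m n" "const_pmat X \<in> carrier_mat n m"
    using assms by auto
  show ?thesis
    unfolding congr_pmat_def
    by (simp only: eval_pmat_mult[OF mult_carrier_mat[OF c(1) assms(1)] c(2)]
      eval_pmat_mult[OF c(1) assms(1)] eval_const_pmat)
qed

lemma det_congr_pmat:
  assumes R: "R \<in> carrier_mat n n" and X: "X \<in> carrier_mat n n"
  shows "det (congr_pmat X R) = [:det (mat_adjoint X) * det X:] * det R"
proof -
  have hom: "comm_ring_hom (\<lambda>c :: complex. [:c:])"
    by unfold_locales (auto simp: one_pCons)
  have c: "det (const_pmat A) = [:det A:]" for A
    unfolding const_pmat_def by (rule comm_ring_hom.hom_det[OF hom])
  have "det (congr_pmat X R) = det (const_pmat (mat_adjoint X)) * det R * det (const_pmat X)"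
    unfolding congr_pmat_def using assms
    by (simp add: det_mult[of _ n] mult_carrier_mat[of _ n n])
  then show ?thesis by (simp add: c mult.commute)
qed

lemma damped_pmat_carrier [simp]:
  "M \<in> carrier_mat n n \<Longrightarrow> D \<in> carrier_mat n n \<Longrightarrow> K \<in> carrier_mat n n \<Longrightarrow> damped_pmat M D K t \<in> carrier_mat n n"
  by (simp add: damped_pmat_def)

text \<open>A constant congruence acts on each coefficient separately and turns it into a Gram
  matrix. The entrywise form lets the block structure be read off from values of the three
  forms.\<close>

lemma congr_damped_pmat:
  assumes vs: "set vs \<subseteq> carrier_vec n"
    and M: "M \<in> carrier_mat n n" and D: "D \<in> carrier_mat n n" and K: "K \<in> carrier_mat n n"
  shows "congr_pmat (mat_of_cols n vs) (damped_pmat M D K t) = mat (length vs) (length vs)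
    (\<lambda>(i, j). [:mform K (vs ! j) (vs ! i), of_real t * mform D (vs ! j) (vs ! i), mform M (vs ! j) (vs ! i):])"
proof -
  let ?X = "mat_of_cols n vs" and ?l = "length vs"
  let ?a = "const_pmat (mat_adjoint ?X)" and ?b = "const_pmat ?X"
  let ?g = "\<lambda>A. mat_adjoint ?X * A * ?X"
  have X: "?X \<in> carrier_mat n ?l" "mat_adjoint ?X \<in> carrier_mat ?l n" by simp_all
  then have ab: "?a \<in> carrier_mat ?l n" "?b \<in> carrier_mat n ?l" by simp_all
  have cg: "?a * const_pmat A * ?b = const_pmat (?g A)" if "A \<in> carrier_mat n n" for A
    by (simp only: const_pmat_mult[OF mult_carrier_mat[OF X(2) that] X(1)] const_pmat_mult[OF X(2) that])
  have sm: "?a * (c \<cdot>\<^sub>m const_pmat A) * ?b = c \<cdot>\<^sub>m const_pmat (?g A)" if A: "A \<in> carrier_mat n n" for A c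
  proof -
    have A': "const_pmat A \<in> carrier_mat n n" using A by simp
    show ?thesis
      by (simp only: cg[OF A, symmetric] mult_smult_distrib[OF ab(1) A']
        mult_smult_assoc_mat[OF mult_carrier_mat[OF ab(1) A'] ab(2)])
  qed
  have ad: "?a * (R + S) * ?b = ?a * R * ?b + ?a * S * ?b"
    if "R \<in> carrier_mat n n" "S \<in> carrier_mat n n" for R S
    by (simp only: mult_add_distrib_mat[OF ab(1) that]
      add_mult_distrib_mat[OF mult_carrier_mat[OF ab(1) that(1)] mult_carrier_mat[OF ab(1) that(2)] ab(2)])
  have "congr_pmat ?X (damped_pmat M D K t) = damped_pmat (?g M) (?g D) (?g K) t"
    unfolding congr_pmat_def damped_pmat_def
    using M D K by (simp add: ad sm cg)
  also have "\<dots> = mat ?l ?l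
    (\<lambda>(i, j). [:mform K (vs ! j) (vs ! i), of_real t * mform D (vs ! j) (vs ! i), mform M (vs ! j) (vs ! i):])"
    unfolding gram_mat[OF vs vs M] gram_mat[OF vs vs D] gram_mat[OF vs vs K]
    by (intro eq_matI) (auto simp: damped_pmat_def const_pmat_def monom_altdef numeral_2_eq_2)
  finally show ?thesis .
qed

text \<open>Flattens the scalar blocks into one diagonal, the shape in which
  \<open>congr_block\<close> delivers the oscillators.\<close>

lemma block_diag_of_scalars:
  fixes c :: "'b \<Rightarrow> 'a :: comm_ring_1"
  shows "diag_block_mat (map (\<lambda>j. c j \<cdot>\<^sub>m 1\<^sub>m (p j)) js) =
    mat_diag (\<Sum>j\<leftarrow>js. p j) (\<lambda>k. concat (map (\<lambda>j. replicate (p j) (c j)) js) ! k)"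
proof (induction js)
  case Nil
  show ?case by (auto simp: mat_diag_def)
next
  case (Cons a js)
  show ?case
    by (intro eq_matI) (auto simp: Cons Let_def mat_diag_def nth_append)
qed

lemma det_mat_diag:
  fixes qs :: "'a :: comm_ring_1 list"
  shows "det (mat_diag (length qs) (\<lambda>k. qs ! k)) = prod_list qs"
proof -
  have "upper_triangular (mat_diag (length qs) (\<lambda>k. qs ! k))"
    by (auto simp: mat_diag_def)
  moreover have "diag_mat (mat_diag (length qs) (\<lambda>k. qs ! k)) = qs"
    by (intro nth_equalityI) (auto simp: diag_mat_def mat_diag_def)
  ultimately show ?thesis using det_upper_triangular[of _ "length qs"] by fastforce
qed

section \<open>Evaluation of the pencil and roots of the oscillator polynomials\<close>

lemma eval_damped_pmat_mult_vec:
  assumes "M \<in> carrier_mat n n" "D \<in> carrier_mat n n" "K \<in> carrier_mat n n" "v \<in> carrier_vec n"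
  shows "eval_pmat (damped_pmat M D K t) z *\<^sub>v v =
    z\<^sup>2 \<cdot>\<^sub>v (M *\<^sub>v v) + (z * of_real t) \<cdot>\<^sub>v (D *\<^sub>v v) + K *\<^sub>v v"
proof -
  have "eval_pmat (damped_pmat M D K t) z = z\<^sup>2 \<cdot>\<^sub>m M + (z * of_real t) \<cdot>\<^sub>m D + K"
    using assms by (intro eq_matI) (auto simp: eval_pmat_def damped_pmat_def const_pmat_def poly_monom)
  moreover have "c \<cdot>\<^sub>m A *\<^sub>v v = c \<cdot>\<^sub>v (A *\<^sub>v v)" if "A \<in> carrier_mat n n" for c and A :: "complex mat"
    using that assms(4) by (intro eq_vecI) auto
  ultimately show ?thesis
    using assms by (simp add: add_mult_distrib_mat_vec[of _ n n])
qed

lemma mform_eval_damped_pmat: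
  assumes "M \<in> carrier_mat n n" "D \<in> carrier_mat n n" "K \<in> carrier_mat n n"
    and "u \<in> carrier_vec n" "v \<in> carrier_vec n"
  shows "mform (eval_pmat (damped_pmat M D K t) z) u v =
    z\<^sup>2 * mform M u v + z * of_real t * mform D u v + mform K u v"
  unfolding mform_def using assms
  by (simp add: eval_damped_pmat_mult_vec[of M n D K] add_scalar_prod_distrib[of _ n])

lemma pmat_spectrum_iff_kernel:
  assumes "R \<in> carrier_mat n n"
  shows "z \<in> pmat_spectrum R \<longleftrightarrow> mat_kernel (eval_pmat R z) \<noteq> {0\<^sub>v n}"
proof -
  have E: "eval_pmat R z \<in> carrier_mat n n" using assms by simp
  have "0\<^sub>v n \<in> mat_kernel (eval_pmat R z)"
    using E by (intro mat_kernelI[OF E]) (auto simp: mult_mat_zero_vec[OF E])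
  then have "mat_kernel (eval_pmat R z) \<noteq> {0\<^sub>v n} \<longleftrightarrow> (\<exists>v \<in> mat_kernel (eval_pmat R z). v \<noteq> 0\<^sub>v n)"
    by blast
  then show ?thesis
    unfolding pmat_spectrum_def mat_kernel[OF E] using det_0_iff_vec_prod_zero_field[OF E] by auto
qed

lemma poly_oscillator_prod:
  fixes z :: complex
  shows "poly (prod_list (map (\<lambda>\<mu>. [:\<mu>, 0, 1:]) \<mu>s)) z = 0 \<longleftrightarrow> - z\<^sup>2 \<in> set \<mu>s"
proof (induction \<mu>s)
  case (Cons \<mu> \<mu>s)
  have "poly [:\<mu>, 0, 1:] z = 0 \<longleftrightarrow> - z\<^sup>2 = \<mu>"
    by (simp add: neg_eq_iff_add_eq_0 power2_eq_square add.commute)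
  then show ?case
    using Cons by (simp only: list.map prod_list.Cons poly_mult mult_eq_0_iff list.set insert_iff)
qed simp

text \<open>The polynomial is (\<lambda> - z)(\<lambda> + z), and the second factor does not vanish
  at a nonzero z.\<close>

lemma order_oscillator_power:
  fixes z :: complex
  assumes "z \<noteq> 0"
  shows "order z ([:- z\<^sup>2, 0, 1:] ^ p) = p"
proof -
  have eq: "[:- z\<^sup>2, 0, 1:] = [:- z, 1:] * [:z, 1:]" by (simp add: power2_eq_square)
  have "order z ([:z, 1:] ^ p) = 0" using assms by (intro order_0I) simp
  moreover have "[:- z, 1:] ^ p * [:z, 1:] ^ p \<noteq> 0" by simp
  ultimately show ?thesis
    unfolding eq power_mult_distrib by (subst order_mult) (simp_all add: order_power_n_n)
qed

section \<open>Damped systems\<close>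

locale damped_system =
  fixes n :: nat and M D K :: "complex mat"
  assumes M: "M \<in> carrier_mat n n" and D: "D \<in> carrier_mat n n" and K: "K \<in> carrier_mat n n"
    and pdM: "pos_definite M" and psdD: "pos_semidefinite D" and pdK: "pos_definite K"
begin

abbreviation "P \<equiv> damped_pmat M D K"

lemma hermM: "hermitian_mat M" and hermD: "hermitian_mat D" and hermK: "hermitian_mat K"
  using pdM psdD pdK by (auto simp: pos_definite_def pos_semidefinite_def)

lemma P_carrier: "P t \<in> carrier_mat n n" and eval_P: "eval_pmat (P t) z \<in> carrier_mat n n"
  using M D K by auto

text \<open>For \<open>\<mu> = \<omega>\<^sup>2\<close> with \<open>\<omega> \<noteq> 0\<close>, this is the nullspace of \<open>P_t (\<plusminus> i \<omega>)\<close>.\<close>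

definition null_modes :: "complex \<Rightarrow> complex vec set" where
  "null_modes \<mu> = {v \<in> carrier_vec n. D *\<^sub>v v = 0\<^sub>v n \<and> K *\<^sub>v v = \<mu> \<cdot>\<^sub>v (M *\<^sub>v v)}"

text \<open>Makes v* P_t(z) v = 0 a scalar quadratic equation with real coefficients of known sign,
  which can be split into real and imaginary parts.\<close>

lemma form_coefficients:
  assumes v: "v \<in> carrier_vec n" "v \<noteq> 0\<^sub>v n"
  obtains m d k :: real where "mform M v v = of_real m" "mform D v v = of_real d" "mform K v v = of_real k"
    "m > 0" "d \<ge> 0" "k > 0"
proof
  show "mform M v v = of_real (Re (mform M v v))" "mform D v v = of_real (Re (mform D v v))"
    "mform K v v = of_real (Re (mform K v v))"
    using mform_self_real[OF hermM M] mform_self_real[OF hermD D] mform_self_real[OF hermK K] v by auto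
  show "Re (mform M v v) > 0" "Re (mform K v v) > 0" "Re (mform D v v) \<ge> 0"
    using pdM pdK psdD M D K v by (auto simp: pos_definite_def pos_semidefinite_def mform_def)
qed

lemma kernel_form_eq:
  assumes v: "v \<in> mat_kernel (eval_pmat (P t) z)"
  shows "z\<^sup>2 * mform M v v + z * of_real t * mform D v v + mform K v v = 0"
proof -
  have vc: "v \<in> carrier_vec n" "eval_pmat (P t) z *\<^sub>v v = 0\<^sub>v n" using mat_kernelD[OF eval_P v] by auto
  then have "mform (eval_pmat (P t) z) v v = 0" by (simp add: mform_def)
  then show ?thesis using mform_eval_damped_pmat[OF M D K vc(1) vc(1)] by simp
qed

text \<open>At z = 0 the form on a null vector reduces to v* K v, which is positive.\<close>

lemma spectrum_nonzero: "z \<in> pmat_spectrum (P t) \<Longrightarrow> z \<noteq> 0"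
proof
  assume "z \<in> pmat_spectrum (P t)" "z = 0"
  then have "mat_kernel (eval_pmat (P t) 0) \<noteq> {0\<^sub>v n}" using pmat_spectrum_iff_kernel[OF P_carrier] by blast
  then obtain v where v: "v \<in> mat_kernel (eval_pmat (P t) 0)" "v \<noteq> 0\<^sub>v n"
    using eval_P[of t 0] mat_kernelI[OF eval_P, of "0\<^sub>v n" t 0] mult_mat_zero_vec[OF eval_P] by fastforce
  then have "v \<in> carrier_vec n" using mat_kernelD[OF eval_P] by blast
  from form_coefficients[OF this v(2)] kernel_form_eq[OF v(1)] show False by fastforce
qed

text \<open>For a root of m z^2 + t d z + k with Re z > 0, the imaginary part forces z to be real,
  and then all terms are nonnegative with k > 0.\<close>

lemma spectrum_Re_le:
  assumes t: "t > 0" and z: "z \<in> pmat_spectrum (P t)"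
  shows "Re z \<le> 0"
proof -
  have "det (eval_pmat (P t) z) = 0" using z by (simp add: pmat_spectrum_def)
  then obtain v where v: "v \<in> carrier_vec n" "v \<noteq> 0\<^sub>v n" "eval_pmat (P t) z *\<^sub>v v = 0\<^sub>v n"
    using det_0_iff_vec_prod_zero_field[OF eval_P] by blast
  obtain m d k where c: "mform M v v = of_real m" "mform D v v = of_real d" "mform K v v = of_real k"
    and pos: "m > 0" "d \<ge> 0" "k > 0" using form_coefficients[OF v(1,2)] .
  have eq: "z\<^sup>2 * of_real m + z * of_real t * of_real d + of_real k = 0"
    using kernel_form_eq[OF mat_kernelI[OF eval_P v(1,3)]] by (simp add: c)
  have re: "((Re z)\<^sup>2 - (Im z)\<^sup>2) * m + Re z * t * d + k = 0"
    using arg_cong[OF eq, of Re] by (simp add: power2_eq_square)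
  have im: "Im z * (2 * Re z * m + t * d) = 0"
    using arg_cong[OF eq, of Im] by (simp add: power2_eq_square algebra_simps)
  show ?thesis
  proof (rule ccontr)
    assume "\<not> ?thesis"
    then have r: "Re z > 0" by simp
    have "2 * Re z * m > 0" "t * d \<ge> 0" using r pos t by auto
    then have "2 * Re z * m + t * d > 0" by linarith
    then have "Im z = 0" using im by simp
    then have "(Re z)\<^sup>2 * m + Re z * t * d + k = 0" using re by simp
    moreover have "(Re z)\<^sup>2 * m > 0" "Re z * t * d \<ge> 0" using r pos t by auto
    ultimately show False using pos by linarith
  qed
qed

lemma kernel_imag_axis:
  assumes t: "t > 0" and z: "Re z = 0" "z \<noteq> 0"
  shows "mat_kernel (eval_pmat (P t) z) = null_modes (- z\<^sup>2)"
proof (intro equalityI subsetI)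
  fix v assume v: "v \<in> mat_kernel (eval_pmat (P t) z)"
  then have vc: "v \<in> carrier_vec n" and ev: "eval_pmat (P t) z *\<^sub>v v = 0\<^sub>v n"
    using mat_kernelD[OF eval_P] by auto
  have Dv: "D *\<^sub>v v = 0\<^sub>v n"
  proof (cases "v = 0\<^sub>v n")
    case True
    then show ?thesis by (simp add: mult_mat_zero_vec[OF D])
  next
    case False
    obtain m d k where c: "mform M v v = of_real m" "mform D v v = of_real d" "mform K v v = of_real k"
      using form_coefficients[OF vc False] .
    have eq: "z\<^sup>2 * of_real m + z * of_real t * of_real d + of_real k = 0"
      using kernel_form_eq[OF v] by (simp add: c)
    \<comment> \<open>On the axis \<open>z\<^sup>2\<close> is real, so the imaginary part isolates
      the damping term.\<close>
    have "Im z * (t * d) = 0"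
      using arg_cong[OF eq, of Im] z by (simp add: power2_eq_square)
    moreover have "Im z \<noteq> 0" using z by (simp add: complex_eq_iff)
    ultimately have "d = 0" using t by simp
    then show ?thesis using pos_semidefinite_null[OF D psdD vc] c by simp
  qed
  have "z\<^sup>2 \<cdot>\<^sub>v (M *\<^sub>v v) + K *\<^sub>v v = 0\<^sub>v n"
    using ev unfolding eval_damped_pmat_mult_vec[OF M D K vc] Dv using M by (auto simp: vec_eq_iff)
  then have *: "(z\<^sup>2 \<cdot>\<^sub>v (M *\<^sub>v v) + K *\<^sub>v v) $ i = 0" if "i < n" for i using that by simp
  have "K *\<^sub>v v = - z\<^sup>2 \<cdot>\<^sub>v (M *\<^sub>v v)"
  proof (intro eq_vecI)
    fix i assume "i < dim_vec (- z\<^sup>2 \<cdot>\<^sub>v (M *\<^sub>v v))"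
    then have i: "i < n" using M by simp
    from *[OF i] show "(K *\<^sub>v v) $ i = (- z\<^sup>2 \<cdot>\<^sub>v (M *\<^sub>v v)) $ i"
      using i M K by (simp add: eq_neg_iff_add_eq_0 add.commute)
  qed (use M K in simp)
  with Dv vc show "v \<in> null_modes (- z\<^sup>2)" by (simp add: null_modes_def)
next
  fix v assume "v \<in> null_modes (- z\<^sup>2)"
  then have v: "v \<in> carrier_vec n" "D *\<^sub>v v = 0\<^sub>v n" "K *\<^sub>v v = - z\<^sup>2 \<cdot>\<^sub>v (M *\<^sub>v v)"
    by (auto simp: null_modes_def)
  have "eval_pmat (P t) z *\<^sub>v v = 0\<^sub>v n"
    unfolding eval_damped_pmat_mult_vec[OF M D K v(1)] using v M by (intro eq_vecI) auto
  then show "v \<in> mat_kernel (eval_pmat (P t) z)" using mat_kernelI[OF eval_P v(1)] by blast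
qed

text \<open>The right-hand side is free of \<open>t\<close>, which is how imaginary eigenvalues are
  compared between different dampings.\<close>

lemma spectrum_imag_axis:
  assumes "t > 0" "Re z = 0"
  shows "z \<in> pmat_spectrum (P t) \<longleftrightarrow> z \<noteq> 0 \<and> null_modes (- z\<^sup>2) \<noteq> {0\<^sub>v n}"
  using pmat_spectrum_iff_kernel[OF P_carrier] kernel_imag_axis assms spectrum_nonzero by metis

lemma null_mode_mform:
  assumes u: "u \<in> null_modes \<mu>" and v: "v \<in> carrier_vec n"
  shows "mform D u v = 0" "mform K u v = \<mu> * mform M u v"
    "mform D v u = 0" "mform K v u = cnj \<mu> * mform M v u"
proof -
  have uc: "u \<in> carrier_vec n" "D *\<^sub>v u = 0\<^sub>v n" "K *\<^sub>v u = \<mu> \<cdot>\<^sub>v (M *\<^sub>v u)"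
    using u by (auto simp: null_modes_def)
  show d: "mform D u v = 0" and k: "mform K u v = \<mu> * mform M u v"
    unfolding mform_def using uc v M by auto
  show "mform D v u = 0" using mform_hermitian[OF hermD D v uc(1)] d by simp
  show "mform K v u = cnj \<mu> * mform M v u"
    using mform_hermitian[OF hermK K v uc(1)] mform_hermitian[OF hermM M v uc(1)] k by simp
qed

text \<open>Evaluating \<open>mform K u v\<close> from either mode gives the value of
  \<open>mform M u v\<close> times \<mu> and times the conjugate of \<nu>.\<close>

lemma null_modes_orthogonal:
  assumes u: "u \<in> null_modes \<mu>" and v: "v \<in> null_modes \<nu>" and ne: "\<mu> \<noteq> cnj \<nu>"
  shows "mform M u v = 0"
proof -
  have "u \<in> carrier_vec n" "v \<in> carrier_vec n" using u v by (auto simp: null_modes_def)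
  then have "\<mu> * mform M u v = cnj \<nu> * mform M u v"
    using null_mode_mform[OF u] null_mode_mform[OF v] by metis
  then show ?thesis using ne by simp
qed

end

section \<open>Bases adapted to undamped modes\<close>

text \<open>Each mode carries its own parameter in \<open>\<mu>s\<close>. One parameter repeated
  serves for the multiplicities at a single frequency, several for splitting off all frequencies
  together.\<close>

locale adapted_basis = damped_system +
  fixes ws us :: "complex vec list" and \<mu>s :: "complex list"
  assumes on_all: "orthonormal_list M (ws @ us)" and len: "length ws + length us = n"
    and len_us: "length \<mu>s = length us"
    and modes: "\<And>k. k < length us \<Longrightarrow> us ! k \<in> null_modes (\<mu>s ! k)"
begin

abbreviation "X1 \<equiv> mat_of_cols n ws"

lemma ws: "set ws \<subseteq> carrier_vec n" and us: "set us \<subseteq> carrier_vec n"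
  using orthonormal_list_carrier[OF on_all M] by auto

lemma on_ws: "orthonormal_list M ws" and on_us: "orthonormal_list M us"
  and ws_us: "w \<in> set ws \<Longrightarrow> u \<in> set us \<Longrightarrow> mform M w u = 0"
  using on_all orthonormal_list_append[OF M hermM] by auto

lemma us_ws: "w \<in> set ws \<Longrightarrow> u \<in> set us \<Longrightarrow> mform M u w = 0"
  using ws_us mform_hermitian[OF hermM M] ws us by (metis complex_cnj_zero subsetD)

lemma X1: "X1 \<in> carrier_mat n (length ws)" by simp

lemma X1_us:
  assumes "y \<in> carrier_vec (length ws)" "u \<in> set us"
  shows "mform M (X1 *\<^sub>v y) u = 0"
  using assms us by (subst mform_mat_of_cols_mult_vec[OF _ ws M]) (auto simp: ws_us)

text \<open>An entry involving a mode has no damping part, and its K-part is a multiple of its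
  M-part. Hence M-orthonormality annihilates the off-diagonal entries and leaves \<lambda>^2 + \<mu>
  on the diagonal.\<close>

lemma congr_block:
  "congr_pmat (mat_of_cols n (ws @ us)) (P t) = four_block_mat (congr_pmat X1 (P t))
     (0\<^sub>m (length ws) (length us)) (0\<^sub>m (length us) (length ws))
     (mat_diag (length us) (\<lambda>k. map (\<lambda>\<mu>. [:\<mu>, 0, 1:]) \<mu>s ! k))"
proof -
  have wsus: "set (ws @ us) \<subseteq> carrier_vec n" using ws us by auto
  have wi: "ws ! i \<in> carrier_vec n" if "i < length ws" for i using that ws nth_mem by blast
  have ui: "us ! i \<in> carrier_vec n" if "i < length us" for i using that us nth_mem by blast
  have uu: "mform M (us ! i) (us ! j) = (if i = j then 1 else 0)" if "i < length us" "j < length us" for i j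
    using that on_us by (simp add: orthonormal_list_def)
  have left: "mform D (us ! k) v = 0" "mform K (us ! k) v = \<mu>s ! k * mform M (us ! k) v"
    if "k < length us" "v \<in> carrier_vec n" for k v
    using null_mode_mform[OF modes[OF that(1)] that(2)] by auto
  have right: "mform D (ws ! i) (us ! k) = 0" "mform K (ws ! i) (us ! k) = 0"
    if "k < length us" "i < length ws" for i k
    using null_mode_mform[OF modes[OF that(1)] wi[OF that(2)]] ws_us that by auto
  show ?thesis
    unfolding congr_damped_pmat[OF wsus M D K] congr_damped_pmat[OF ws M D K]
  proof (intro eq_matI, goal_cases)
    case (1 i j)
    then have i: "i < length ws + length us" and j: "j < length ws + length us"
      by (auto simp: mat_diag_def)
    have i': "i - length ws < length us" if "\<not> i < length ws" using i that by linarith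
    have j': "j - length ws < length us" if "\<not> j < length ws" using j that by linarith
    show ?case
      using i j wi ui us_ws ws_us i' j' len_us
      by (auto simp: nth_append mat_diag_def uu left right)
  qed (simp_all add: mat_diag_def)
qed

lemma congr_X1: "congr_pmat X1 (P t) \<in> carrier_mat (length ws) (length ws)"
  unfolding congr_damped_pmat[OF ws M D K] by simp

lemma det_P:
  obtains c where "c \<noteq> 0"
    "[:c:] * det (P t) = det (congr_pmat X1 (P t)) * prod_list (map (\<lambda>\<mu>. [:\<mu>, 0, 1:]) \<mu>s)"
proof
  let ?X = "mat_of_cols n (ws @ us)"
  let ?q = "length us" and ?d = "mat_diag (length us) (\<lambda>k. map (\<lambda>\<mu>. [:\<mu>, 0, 1:]) \<mu>s ! k)"
  have X: "?X \<in> carrier_mat n n" "mat_adjoint ?X \<in> carrier_mat n n"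
    using len mat_of_cols_carrier(1)[of n "ws @ us"] by auto
  have "det (mat_adjoint ?X * M * ?X) = 1" using orthonormal_list_gram[OF M on_all] by simp
  then have "det (mat_adjoint ?X) * det M * det ?X = 1"
    using det_mult[OF mult_carrier_mat[OF X(2) M] X(1)] det_mult[OF X(2) M] by simp
  then show "det (mat_adjoint ?X) * det ?X \<noteq> 0" by auto
  have "[:det (mat_adjoint ?X) * det ?X:] * det (P t) = det (congr_pmat ?X (P t))"
    by (simp only: det_congr_pmat[OF P_carrier X(1)])
  also have "\<dots> = det (congr_pmat X1 (P t)) * det ?d"
    unfolding congr_block by (rule det_four_block_mat_upper_right_zero[OF congr_X1]) auto
  also have "det ?d = prod_list (map (\<lambda>\<mu>. [:\<mu>, 0, 1:]) \<mu>s)"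
    using det_mat_diag[of "map (\<lambda>\<mu>. [:\<mu>, 0, 1:]) \<mu>s"] len_us by simp
  finally show "[:det (mat_adjoint ?X) * det ?X:] * det (P t) =
     det (congr_pmat X1 (P t)) * prod_list (map (\<lambda>\<mu>. [:\<mu>, 0, 1:]) \<mu>s)" .
qed

lemma spectrum_congr_X1:
  "z \<in> pmat_spectrum (P t) \<longleftrightarrow> z \<in> pmat_spectrum (congr_pmat X1 (P t)) \<or> - z\<^sup>2 \<in> set \<mu>s"
proof -
  obtain c where c: "c \<noteq> 0"
    "[:c:] * det (P t) = det (congr_pmat X1 (P t)) * prod_list (map (\<lambda>\<mu>. [:\<mu>, 0, 1:]) \<mu>s)"
    by (rule det_P)
  show ?thesis
    using arg_cong[OF c(2), of "\<lambda>q. poly q z"] c(1) poly_oscillator_prod[of \<mu>s z]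
    by (auto simp: pmat_spectrum_def poly_det_eval_pmat[symmetric])
qed

lemma mform_eval_us:
  assumes y: "y \<in> carrier_vec (length ws)" and u: "u \<in> set us"
  shows "mform (eval_pmat (P t) z) (X1 *\<^sub>v y) u = 0"
proof -
  have Xy: "X1 *\<^sub>v y \<in> carrier_vec n" using mult_mat_vec_carrier[OF X1 y] .
  obtain k where k: "k < length us" "u = us ! k" using u by (metis in_set_conv_nth)
  have "u \<in> carrier_vec n" using u us by blast
  then show ?thesis
    using mform_eval_damped_pmat[OF M D K Xy] null_mode_mform[OF modes[OF k(1)] Xy] X1_us[OF y u] k(2)
    by simp
qed

lemma zeroI:
  assumes g: "g \<in> carrier_vec n" and "\<And>w. w \<in> set ws \<Longrightarrow> g \<bullet>c w = 0" "\<And>u. u \<in> set us \<Longrightarrow> g \<bullet>c u = 0"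
  shows "g = 0\<^sub>v n"
  using assms len by (intro orthonormal_basis_zeroI[OF M on_all]) auto

text \<open>If the compressed matrix kills y, then P_t(z) X_1 y is orthogonal to \<open>ws\<close>,
  and to \<open>us\<close> anyway because these are modes. So X_1 y is a null vector of P_t(z) that
  is M-orthogonal to \<open>us\<close>, and completeness makes it zero.\<close>

lemma not_in_spectrum_congr_X1:
  assumes complete: "\<And>v. v \<in> mat_kernel (eval_pmat (P t) z) \<Longrightarrow> \<forall>u \<in> set us. mform M v u = 0 \<Longrightarrow> v = 0\<^sub>v n"
  shows "z \<notin> pmat_spectrum (congr_pmat X1 (P t))"
proof
  let ?E = "eval_pmat (P t) z"
  assume "z \<in> pmat_spectrum (congr_pmat X1 (P t))"
  then have "det (mat_adjoint X1 * ?E * X1) = 0"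
    by (simp add: pmat_spectrum_def eval_congr_pmat[OF P_carrier X1])
  moreover have "mat_adjoint X1 * ?E * X1 \<in> carrier_mat (length ws) (length ws)"
    using eval_P mat_adjoint_carrier[OF X1] by (intro mult_carrier_mat[OF mult_carrier_mat X1])
  ultimately obtain y where y: "y \<in> carrier_vec (length ws)" "y \<noteq> 0\<^sub>v (length ws)"
      "mat_adjoint X1 * ?E * X1 *\<^sub>v y = 0\<^sub>v (length ws)"
    using det_0_iff_vec_prod_zero_field by blast
  have Xy: "X1 *\<^sub>v y \<in> carrier_vec n" using mult_mat_vec_carrier[OF X1 y(1)] .
  have "(?E *\<^sub>v (X1 *\<^sub>v y)) \<bullet>c w = 0" if w: "w \<in> set ws" for w
  proof -
    obtain k where k: "k < length ws" "w = ws ! k" using w by (metis in_set_conv_nth)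
    show ?thesis
      using y(3) k unfolding gram_mat_mult_vec[OF ws ws eval_P y(1)] mform_def
      by (metis index_vec index_zero_vec(1))
  qed
  then have "?E *\<^sub>v (X1 *\<^sub>v y) = 0\<^sub>v n"
    using mform_eval_us[OF y(1)] mult_mat_vec_carrier[OF eval_P Xy] by (intro zeroI) (auto simp: mform_def)
  then have "X1 *\<^sub>v y = 0\<^sub>v n"
    using complete mat_kernelI[OF eval_P Xy] X1_us[OF y(1)] by blast
  then show False using orthonormal_list_inj[OF M on_ws y(1)] y(2) by blast
qed

end

context adapted_basis
begin

text \<open>The column space of \<open>[P_0(z) D]\<close> is the \<open>M\<close>-image of the span of \<open>ws\<close>.\<close>

lemma rank_block_row:
  assumes z: "Re z = 0" "z \<noteq> 0"
    and \<mu>: "\<And>u. u \<in> set us \<Longrightarrow> u \<in> null_modes (- z\<^sup>2)"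
    and complete: "\<And>v. v \<in> null_modes (- z\<^sup>2) \<Longrightarrow> \<forall>u \<in> set us. mform M v u = 0 \<Longrightarrow> v = 0\<^sub>v n"
  shows "vec_space.rank n (block_row (eval_pmat (damped_pmat M (0\<^sub>m n n) K 1) z) D) = length ws"
proof -
  let ?A = "eval_pmat (damped_pmat M (0\<^sub>m n n) K 1) z"
  let ?E = "eval_pmat (P 1) z"
  let ?Mws = "map (\<lambda>w. M *\<^sub>v w) ws"
  have A: "?A \<in> carrier_mat n n" using M K by simp
  have B: "block_row ?A D \<in> carrier_mat n (n + n)" using A D by (auto simp: block_row_def intro!: carrier_matI)
  have Mws: "set ?Mws \<subseteq> carrier_vec n" using ws M by auto
  have mult: "mat_of_cols n ?Mws *\<^sub>v y = M *\<^sub>v (X1 *\<^sub>v y)" if y: "y \<in> carrier_vec (length ?Mws)" for y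
  proof -
    have "mat_of_cols n ?Mws = M * X1"
      using ws M nth_mem by (intro eq_matI) (fastforce simp: mat_of_cols_index)+
    then show ?thesis using assoc_mult_mat_vec[OF M X1] y by simp
  qed
  have inj: "y = 0\<^sub>v (length ?Mws)" if y: "y \<in> carrier_vec (length ?Mws)" and "mat_of_cols n ?Mws *\<^sub>v y = 0\<^sub>v n" for y
  proof (intro eq_vecI)
    fix k assume "k < dim_vec (0\<^sub>v (length ?Mws))"
    then have k: "k < length ws" by simp
    have wk: "ws ! k \<in> carrier_vec n" using k ws nth_mem by blast
    have "mform M (X1 *\<^sub>v y) (ws ! k) = 0"
      using that mult[OF y] wk by (simp add: mform_def)
    then show "y $ k = 0\<^sub>v (length ?Mws) $ k"
      using orthonormal_list_coords[OF M on_ws _ k] y k by simp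
  qed (use y in simp)
  have dist: "distinct ?Mws"
  proof -
    have "inj_on (\<lambda>w. M *\<^sub>v w) (set ws)"
    proof
      fix v w assume vw: "v \<in> set ws" "w \<in> set ws" "M *\<^sub>v v = M *\<^sub>v w"
      have c: "v \<in> carrier_vec n" "w \<in> carrier_vec n" using vw ws by auto
      have "mform M v w = mform M w w" using vw(3) by (simp add: mform_def)
      then show "v = w" using vw(1,2) on_ws
        unfolding orthonormal_list_def by (metis in_set_conv_nth zero_neq_one)
    qed
    then show ?thesis using orthonormal_list_distinct[OF on_ws] by (simp add: distinct_map)
  qed
  have kerE: "mat_kernel ?E = null_modes (- z\<^sup>2)" by (rule kernel_imag_axis[OF _ z]) simp
  have "(\<lambda>x. block_row ?A D *\<^sub>v x) ` carrier_vec (n + n) =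
     (\<lambda>y. mat_of_cols n ?Mws *\<^sub>v y) ` carrier_vec (length ?Mws)"
  proof (intro equalityI subsetI)
    fix g assume "g \<in> (\<lambda>x. block_row ?A D *\<^sub>v x) ` carrier_vec (n + n)"
    then obtain x where x: "x \<in> carrier_vec (n + n)" and g: "g = block_row ?A D *\<^sub>v x" by blast
    define a b where "a = vec_first x n" and "b = vec_last x n"
    have ab: "a \<in> carrier_vec n" "b \<in> carrier_vec n" "x = a @\<^sub>v b"
      using x by (auto simp: a_def b_def)
    have g: "g = ?A *\<^sub>v a + D *\<^sub>v b" unfolding g ab(3) by (rule block_row_mult_vec[OF A D ab(1,2)])
    have gc: "g \<in> carrier_vec n" using g A D ab by simp
    \<comment> \<open>Modes are orthogonal to the ranges of P_0(z) and of D. The conjugated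
      parameter of \<open>null_mode_mform\<close> is harmless because \<open>z\<^sup>2\<close> is
      real.\<close>
    have gu: "g \<bullet>c u = 0" if u: "u \<in> set us" for u
    proof -
      have uc: "u \<in> carrier_vec n" using u us by blast
      have "cnj (z\<^sup>2) = z\<^sup>2" using z by (simp add: complex_eq_iff power2_eq_square)
      moreover have "0\<^sub>m n n *\<^sub>v a = 0\<^sub>v n" by (rule zero_mat_mult_vec[OF ab(1)])
      ultimately have "mform ?A a u = 0"
        using mform_eval_damped_pmat[OF M _ K ab(1) uc, of "0\<^sub>m n n" 1 z] null_mode_mform[OF \<mu>[OF u] ab(1)] ab uc
        by (simp add: mform_def[of "0\<^sub>m n n"])
      then show ?thesis
        using g null_mode_mform(3)[OF \<mu>[OF u] ab(2)] A D ab uc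
        by (simp add: mform_def add_scalar_prod_distrib[of _ n])
    qed
    \<comment> \<open>Since X_1* M X_1 = I, these coefficients make g - M X_1 y orthogonal to
      \<open>ws\<close>; both terms are already orthogonal to \<open>us\<close>.\<close>
    define y where "y = vec (length ws) (\<lambda>k. g \<bullet>c (ws ! k))"
    have y: "y \<in> carrier_vec (length ws)" by (simp add: y_def)
    have Xy: "X1 *\<^sub>v y \<in> carrier_vec n" using mult_mat_vec_carrier[OF X1 y] .
    have MXy: "M *\<^sub>v (X1 *\<^sub>v y) \<in> carrier_vec n" using mult_mat_vec_carrier[OF M Xy] .
    have "g - M *\<^sub>v (X1 *\<^sub>v y) = 0\<^sub>v n"
    proof (rule zeroI)
      show "(g - M *\<^sub>v (X1 *\<^sub>v y)) \<bullet>c w = 0" if w: "w \<in> set ws" for w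
      proof -
        obtain k where k: "k < length ws" "w = ws ! k" using w by (metis in_set_conv_nth)
        have "mform M (X1 *\<^sub>v y) w = y $ k" using orthonormal_list_coords[OF M on_ws y k(1)] k(2) by simp
        moreover have "w \<in> carrier_vec n" using w ws by blast
        ultimately show ?thesis
          using k gc MXy by (simp add: minus_scalar_prod_distrib[of _ n] mform_def y_def)
      qed
      show "(g - M *\<^sub>v (X1 *\<^sub>v y)) \<bullet>c u = 0" if u: "u \<in> set us" for u
      proof -
        have "u \<in> carrier_vec n" using u us by blast
        then show ?thesis
          using gu[OF u] X1_us[OF y u] gc MXy by (simp add: minus_scalar_prod_distrib[of _ n] mform_def)
      qed
    qed (use gc MXy in simp)
    then have "g = M *\<^sub>v (X1 *\<^sub>v y)" by (rule eq_vec_if_diff_zero[OF gc MXy])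
    then show "g \<in> (\<lambda>y. mat_of_cols n ?Mws *\<^sub>v y) ` carrier_vec (length ?Mws)" using mult y by auto
  next
    fix g assume "g \<in> (\<lambda>y. mat_of_cols n ?Mws *\<^sub>v y) ` carrier_vec (length ?Mws)"
    then obtain y where y: "y \<in> carrier_vec (length ws)" and g: "g = M *\<^sub>v (X1 *\<^sub>v y)" using mult by auto
    have gc: "g \<in> carrier_vec n"
      using g mult_mat_vec_carrier[OF M mult_mat_vec_carrier[OF X1 y]] by simp
    let ?Q = "mat_adjoint X1 * ?E * X1"
    have Q: "?Q \<in> carrier_mat (length ws) (length ws)"
      using eval_P mat_adjoint_carrier[OF X1] by (intro mult_carrier_mat[OF mult_carrier_mat X1])
    \<comment> \<open>For the converse inclusion, P_1(z) x = g is solved with x in the span of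
      \<open>ws\<close>: all modes at z are split off, so the compressed matrix is
      invertible.\<close>
    have "z \<notin> pmat_spectrum (congr_pmat X1 (P 1))"
      using complete kerE by (intro not_in_spectrum_congr_X1) auto
    then have "det ?Q \<noteq> 0" by (simp add: pmat_spectrum_def eval_congr_pmat[OF P_carrier X1])
    then obtain R where R: "R \<in> carrier_mat (length ws) (length ws)" "?Q * R = 1\<^sub>m (length ws)"
      using det_non_zero_imp_unit[OF Q] by (auto simp: Units_def ring_mat_def)
    define y' where "y' = R *\<^sub>v y"
    have y': "y' \<in> carrier_vec (length ws)" using R y by (simp add: y'_def)
    have Qy': "?Q *\<^sub>v y' = y" using assoc_mult_mat_vec[OF Q R(1) y] R(2) y by (simp add: y'_def)
    define x where "x = X1 *\<^sub>v y'"
    have x: "x \<in> carrier_vec n" using mult_mat_vec_carrier[OF X1 y'] by (simp add: x_def)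
    have Ex: "?E *\<^sub>v x \<in> carrier_vec n" using mult_mat_vec_carrier[OF eval_P x] .
    have "g - ?E *\<^sub>v x = 0\<^sub>v n"
    proof (rule zeroI)
      show "(g - ?E *\<^sub>v x) \<bullet>c w = 0" if w: "w \<in> set ws" for w
      proof -
        obtain k where k: "k < length ws" "w = ws ! k" using w by (metis in_set_conv_nth)
        have "mform ?E x w = y $ k"
          using gram_mat_mult_vec[OF ws ws eval_P y'] Qy' k unfolding x_def by (metis index_vec)
        moreover have "mform M (X1 *\<^sub>v y) w = y $ k"
          using orthonormal_list_coords[OF M on_ws y k(1)] k(2) by simp
        moreover have "w \<in> carrier_vec n" using w ws by blast
        ultimately show ?thesis
          using gc Ex g by (simp add: minus_scalar_prod_distrib[of _ n] mform_def)
      qed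
      show "(g - ?E *\<^sub>v x) \<bullet>c u = 0" if u: "u \<in> set us" for u
      proof -
        have "u \<in> carrier_vec n" using u us by blast
        then show ?thesis
          using mform_eval_us[OF y' u, of 1 z] X1_us[OF y u] gc Ex g
          by (simp add: minus_scalar_prod_distrib[of _ n] mform_def x_def)
      qed
    qed (use gc Ex in simp)
    then have gE: "g = ?E *\<^sub>v x" by (rule eq_vec_if_diff_zero[OF gc Ex])
    \<comment> \<open>The witness comes from P_1(z) x = P_0(z) x + D (z x); with t = 1 no further
      scaling appears.\<close>
    have "g = block_row ?A D *\<^sub>v (x @\<^sub>v (z \<cdot>\<^sub>v x))"
      unfolding block_row_mult_vec[OF A D x smult_carrier_vec[THEN iffD2, OF x]] gE
        eval_damped_pmat_mult_vec[OF M D K x] eval_damped_pmat_mult_vec[OF M zero_carrier_mat K x]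
      using M D K x by (intro eq_vecI) (auto simp: mult_mat_vec[of D n n])
    moreover have "x @\<^sub>v (z \<cdot>\<^sub>v x) \<in> carrier_vec (n + n)" using x by simp
    ultimately show "g \<in> (\<lambda>x. block_row ?A D *\<^sub>v x) ` carrier_vec (n + n)" by blast
  qed
  then show ?thesis using vec_space.rank_eq_length[OF B Mws dist inj] by simp
qed

end

section \<open>Complete lists of modes and the multiplicities they determine\<close>

context damped_system
begin

lemma adapted_basisI:
  assumes "orthonormal_list M us" "length \<mu>s = length us"
    and "\<And>k. k < length us \<Longrightarrow> us ! k \<in> null_modes (\<mu>s ! k)"
  obtains ws where "adapted_basis n M D K ws us \<mu>s"
  using orthonormal_list_complement[OF M pdM assms(1)] assms(2,3)
  by (metis adapted_basis.intro adapted_basis_axioms.intro damped_system_axioms)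

lemma null_modes_subset: "null_modes \<mu> \<subseteq> carrier_vec n"
  by (auto simp: null_modes_def)

text \<open>Completeness is stated as the absence of a nonzero orthogonal mode, the form that
  maximality provides; spanning follows by expansion.\<close>

definition null_basis :: "complex \<Rightarrow> complex vec list \<Rightarrow> bool" where
  "null_basis \<mu> us \<longleftrightarrow> orthonormal_list M us \<and> set us \<subseteq> null_modes \<mu> \<and>
     (\<forall>v \<in> null_modes \<mu>. (\<forall>u \<in> set us. mform M v u = 0) \<longrightarrow> v = 0\<^sub>v n)"

text \<open>Starting from a given list allows a complete list of damped modes to be enlarged to one
  of undamped modes.\<close>

lemma null_basis_extend:
  assumes "orthonormal_list M us" "set us \<subseteq> null_modes \<mu>"
  obtains ws where "null_basis \<mu> (us @ ws)"
proof -
  have "c \<cdot>\<^sub>v v \<in> null_modes \<mu>" if "v \<in> null_modes \<mu>" for c v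
    using that M D K by (auto simp: null_modes_def mult_mat_vec[of _ n n] smult_smult_assoc mult.commute)
  from orthonormal_list_extend[OF M pdM assms null_modes_subset this] show thesis
    using that assms(2) by (auto simp: null_basis_def)
qed

lemma null_basis_trivial_iff:
  assumes "null_basis \<mu> us"
  shows "null_modes \<mu> = {0\<^sub>v n} \<longleftrightarrow> us = []"
proof
  assume *: "null_modes \<mu> = {0\<^sub>v n}"
  show "us = []"
  proof (rule ccontr)
    assume "us \<noteq> []"
    then have l: "0 < length us" by simp
    then have "us ! 0 \<in> null_modes \<mu>" using assms nth_mem by (auto simp: null_basis_def)
    then have "mform M (us ! 0) (us ! 0) = 0" using * mform_zero_left[OF M] by auto
    then show False using assms l by (auto simp: null_basis_def orthonormal_list_def)
  qed
next
  assume "us = []"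
  moreover have "0\<^sub>v n \<in> null_modes \<mu>"
    by (simp add: null_modes_def mult_mat_zero_vec[OF M] mult_mat_zero_vec[OF D] mult_mat_zero_vec[OF K]
      smult_zero_vec_right)
  moreover have "v = 0\<^sub>v n" if "v \<in> null_modes \<mu>" for v
    using assms that \<open>us = []\<close> unfolding null_basis_def by simp
  ultimately show "null_modes \<mu> = {0\<^sub>v n}" by blast
qed

text \<open>Splitting off \<open>us\<close> leaves \<open>length ws\<close> as the rank. The list is
  a basis of the nullspace at z, and it contributes the factor (\<lambda>^2 - z^2)^p to the
  determinant, p being its length.\<close>

lemma null_basis_properties:
  assumes z: "Re z = 0" "z \<noteq> 0" and nb: "null_basis (- z\<^sup>2) us"
  shows "vec_space.rank n (block_row (eval_pmat (damped_pmat M (0\<^sub>m n n) K 1) z) D) + length us = n"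
    and "t > 0 \<Longrightarrow> geom_mult (P t) z = length us"
    and "t > 0 \<Longrightarrow> alg_mult (P t) z = length us"
proof -
  let ?\<mu> = "replicate (length us) (- z\<^sup>2)"
  have on: "orthonormal_list M us" and sub: "set us \<subseteq> null_modes (- z\<^sup>2)"
    and complete: "\<And>v. v \<in> null_modes (- z\<^sup>2) \<Longrightarrow> \<forall>u \<in> set us. mform M v u = 0 \<Longrightarrow> v = 0\<^sub>v n"
    using nb by (auto simp: null_basis_def)
  obtain ws where "adapted_basis n M D K ws us ?\<mu>"
  proof (rule adapted_basisI[OF on])
    show "us ! k \<in> null_modes (?\<mu> ! k)" if "k < length us" for k
      using that sub nth_mem by auto
  qed simp_all
  then interpret adapted_basis n M D K ws us ?\<mu> .
  show "vec_space.rank n (block_row (eval_pmat (damped_pmat M (0\<^sub>m n n) K 1) z) D) + length us = n"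
  proof -
    have "vec_space.rank n (block_row (eval_pmat (damped_pmat M (0\<^sub>m n n) K 1) z) D) = length ws"
      using sub by (intro rank_block_row[OF z _ complete]) blast+
    then show ?thesis using len by linarith
  qed
  show "geom_mult (P t) z = length us" if t: "t > 0"
    unfolding geom_mult_def
  proof (rule kernel_dim_eq_length[OF eval_P])
    note ker = kernel_imag_axis[OF t z]
    show s: "set us \<subseteq> mat_kernel (eval_pmat (P t) z)" using sub ker by simp
    show "distinct us" by (rule orthonormal_list_distinct[OF on])
    show "w = 0\<^sub>v (length us)" if "w \<in> carrier_vec (length us)" "mat_of_cols n us *\<^sub>v w = 0\<^sub>v n" for w
      using orthonormal_list_inj[OF M on that] .
    fix u assume u: "u \<in> mat_kernel (eval_pmat (P t) z)"
    have "\<forall>u \<in> mat_kernel (eval_pmat (P t) z). (\<forall>v \<in> set us. mform M u v = 0) \<longrightarrow> u = 0\<^sub>v n"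
      using complete ker by blast
    from complete_orthonormal_list_expansion[OF M on eval_P s this u]
    show "\<exists>w \<in> carrier_vec (length us). u = mat_of_cols n us *\<^sub>v w"
      by (intro bexI[of _ "vec (length us) (\<lambda>k. mform M u (us ! k))"]) auto
  qed
  show "alg_mult (P t) z = length us" if t: "t > 0"
  proof -
    obtain c where c: "c \<noteq> 0"
      "[:c:] * det (P t) = det (congr_pmat X1 (P t)) * prod_list (map (\<lambda>\<mu>. [:\<mu>, 0, 1:]) ?\<mu>)"
      using det_P by metis
    have nz: "det (P t) \<noteq> 0" by (rule det_damped_pmat_nonzero[OF M D K pdK])
    \<comment> \<open>The remaining factor of the determinant is nonzero at z, so the order of the
      root comes from the oscillators alone.\<close>
    have "z \<notin> pmat_spectrum (congr_pmat X1 (P t))"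
      using complete kernel_imag_axis[OF t z] by (intro not_in_spectrum_congr_X1) auto
    then have o1: "order z (det (congr_pmat X1 (P t))) = 0"
      by (intro order_0I) (simp add: pmat_spectrum_def poly_det_eval_pmat)
    have eq: "Polynomial.smult c (det (P t)) = det (congr_pmat X1 (P t)) * [:- z\<^sup>2, 0, 1:] ^ length us"
      using c(2) by (simp add: map_replicate_const prod_list_replicate)
    have "order z (det (P t)) = order z (Polynomial.smult c (det (P t)))"
      using c(1) by (simp add: order_smult)
    also have "\<dots> = length us"
    proof -
      have "Polynomial.smult c (det (P t)) \<noteq> 0" using c(1) nz by simp
      then have ne: "det (congr_pmat X1 (P t)) * [:- z\<^sup>2, 0, 1:] ^ length us \<noteq> 0" using eq by simp
      show ?thesis unfolding eq order_mult[OF ne] o1 order_oscillator_power[OF z(2)] by simp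
    qed
    finally show ?thesis by (simp add: alg_mult_def)
  qed
qed

end

section \<open>Zero damping, conjugate pairs and oscillator blocks\<close>

lemma eval_undamped_pmat:
  assumes "M \<in> carrier_mat n n" "K \<in> carrier_mat n n"
  shows "eval_pmat (undamped_pmat M K) z = z\<^sup>2 \<cdot>\<^sub>m M + K"
  using assms by (intro eq_matI) (auto simp: eval_pmat_def undamped_pmat_def const_pmat_def poly_monom)

lemma damped_pmat_zero_damping:
  assumes "M \<in> carrier_mat n n" "K \<in> carrier_mat n n"
  shows "damped_pmat M (0\<^sub>m n n) K t = undamped_pmat M K"
  using assms by (intro eq_matI) (auto simp: damped_pmat_def undamped_pmat_def const_pmat_def)

lemma pos_semidefinite_zero: "pos_semidefinite (0\<^sub>m n n)"
proof -
  have c: "mat_adjoint (0\<^sub>m n n :: complex mat) \<in> carrier_mat n n" by simp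
  have "mat_adjoint (0\<^sub>m n n) = (0\<^sub>m n n :: complex mat)"
    by (intro eq_matI) (auto simp: mat_adjoint_index carrier_matD[OF c])
  then show ?thesis by (auto simp: pos_semidefinite_def hermitian_mat_def zero_mat_mult_vec)
qed

lemma orthonormal_list_concat:
  assumes M: "M \<in> carrier_mat n n" and h: "hermitian_mat M" and "distinct js"
    and "\<And>j. j \<in> set js \<Longrightarrow> orthonormal_list M (U j)"
    and "\<And>i j u v. i \<in> set js \<Longrightarrow> j \<in> set js \<Longrightarrow> i \<noteq> j \<Longrightarrow> u \<in> set (U i) \<Longrightarrow> v \<in> set (U j) \<Longrightarrow> mform M u v = 0"
  shows "orthonormal_list M (concat (map U js))"
  using assms(3-)
proof (induction js)
  case Nil
  show ?case by (simp add: orthonormal_list_def)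
next
  case (Cons a js)
  have "orthonormal_list M (concat (map U js))"
  proof (rule Cons.IH)
    show "mform M u v = 0" if "i \<in> set js" "j \<in> set js" "i \<noteq> j" "u \<in> set (U i)" "v \<in> set (U j)" for i j u v
      using Cons.prems(3)[of i j u v] that by simp
  qed (use Cons.prems(1,2) in simp_all)
  moreover have "mform M u v = 0" if u: "u \<in> set (U a)" and v: "v \<in> set (concat (map U js))" for u v
  proof -
    obtain j where "j \<in> set js" "v \<in> set (U j)" using v by auto
    then show ?thesis using Cons.prems(1) Cons.prems(3)[of a j u v] u by auto
  qed
  ultimately show ?case using Cons.prems(2)[of a] orthonormal_list_append[OF M h] by simp
qed

text \<open>Translates a pair of eigenvalues into the single parameter used by
  \<open>null_modes\<close>, through the factorisation of z^2 + \<omega>^2.\<close>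

lemma conj_pair_iff: "z \<in> conj_pair \<omega> \<longleftrightarrow> - z\<^sup>2 = of_real (\<omega>\<^sup>2)"
proof -
  have "- z\<^sup>2 = of_real (\<omega>\<^sup>2) \<longleftrightarrow> (z - \<i> * of_real \<omega>) * (z + \<i> * of_real \<omega>) = 0"
    by (simp add: algebra_simps power2_eq_square neg_eq_iff_add_eq_0 add.commute)
  then show ?thesis by (auto simp: conj_pair_def eq_neg_iff_add_eq_0)
qed

lemma conj_pair_Re: "z \<in> conj_pair \<omega> \<Longrightarrow> Re z = 0"
  by (auto simp: conj_pair_def)

lemma oscillator_pmat_mat_diag:
  fixes l :: nat and \<omega> :: "nat \<Rightarrow> real" and p :: "nat \<Rightarrow> nat"
  defines "\<mu>s \<equiv> concat (map (\<lambda>j. replicate (p j) (complex_of_real ((\<omega> j)\<^sup>2))) [1..<Suc l])"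
  shows "oscillator_pmat l \<omega> p = mat_diag (length \<mu>s) (\<lambda>k. map (\<lambda>\<mu>. [:\<mu>, 0, 1:]) \<mu>s ! k)"
proof -
  have "map (\<lambda>\<mu>. [:\<mu>, 0, 1:]) \<mu>s =
      concat (map (\<lambda>j. replicate (p j) [:of_real ((\<omega> j)\<^sup>2), 0, 1:]) [1..<Suc l])"
    unfolding \<mu>s_def by (simp add: map_concat comp_def del: upt_Suc)
  moreover have "length \<mu>s = (\<Sum>j\<leftarrow>[1..<Suc l]. p j)"
    unfolding \<mu>s_def by (simp add: length_concat comp_def del: upt_Suc)
  ultimately show ?thesis
    unfolding oscillator_pmat_def block_diag_of_scalars by simp
qed

section \<open>Comparison with the undamped pencil and decoupling\<close>

context damped_system
begin

abbreviation "P\<^sub>0 \<equiv> undamped_pmat M K"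

sublocale undamped: damped_system n M "0\<^sub>m n n" K
  using M K pdM pdK pos_semidefinite_zero by unfold_locales auto

text \<open>With zero damping the parameter is irrelevant, so results that assume t > 0 reach the
  undamped pencil through the arbitrary choice t = 1.\<close>

lemma undamped_P: "undamped.P t = P\<^sub>0"
  by (rule damped_pmat_zero_damping[OF M K])

lemma null_modes_undamped: "null_modes \<mu> \<subseteq> undamped.null_modes \<mu>"
  by (auto simp: null_modes_def undamped.null_modes_def)

lemma null_basis_exists: obtains us where "null_basis \<mu> us"
  using null_basis_extend[of "[]" \<mu>] by (auto simp: orthonormal_list_def)

lemma spectrum_imag_axis_subset:
  assumes "t > 0"
  shows "pmat_spectrum (P t) \<inter> imag_axis \<subseteq> pmat_spectrum P\<^sub>0"
proof
  fix z assume "z \<in> pmat_spectrum (P t) \<inter> imag_axis"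
  then have z: "Re z = 0" "z \<noteq> 0" and ne: "null_modes (- z\<^sup>2) \<noteq> {0\<^sub>v n}"
    using spectrum_imag_axis[OF assms] by (auto simp: imag_axis_def)
  obtain us where us: "null_basis (- z\<^sup>2) us" by (rule null_basis_exists)
  then have "us \<noteq> []" using ne null_basis_trivial_iff by blast
  moreover have "orthonormal_list M us" "set us \<subseteq> undamped.null_modes (- z\<^sup>2)"
    using us null_modes_undamped[of "- z\<^sup>2"] unfolding null_basis_def by blast+
  then obtain ws where "undamped.null_basis (- z\<^sup>2) (us @ ws)"
    by (rule undamped.null_basis_extend)
  ultimately have "undamped.null_modes (- z\<^sup>2) \<noteq> {0\<^sub>v n}"
    using undamped.null_basis_trivial_iff by blast
  then show "z \<in> pmat_spectrum P\<^sub>0"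
    using undamped.spectrum_imag_axis[of 1 z] z by (simp add: undamped_P)
qed

text \<open>The rank is given as rank + p = n, which keeps truncated subtraction out; p = 0 is the
  full rank case.\<close>

lemma multiplicities:
  assumes \<omega>: "\<i> * of_real \<omega> \<in> pmat_spectrum P\<^sub>0"
    and rank: "vec_space.rank n (block_row (eval_pmat P\<^sub>0 (\<i> * of_real \<omega>)) D) + p = n"
    and t: "t > 0" and z: "z \<in> conj_pair \<omega>"
  shows "z \<in> pmat_spectrum (P t) \<longleftrightarrow> p \<noteq> 0"
    and "geom_mult (P t) z = p" "alg_mult (P t) z = p"
    and "alg_mult P\<^sub>0 z = geom_mult P\<^sub>0 (\<i> * of_real \<omega>)"
    and "p \<le> geom_mult P\<^sub>0 (\<i> * of_real \<omega>)"
    and "mat_kernel (eval_pmat (P t) z) = null_modes (of_real (\<omega>\<^sup>2))"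
proof -
  let ?z = "\<i> * complex_of_real \<omega>"
  have "\<omega> \<noteq> 0" using undamped.spectrum_nonzero[of ?z 1] \<omega> by (auto simp: undamped_P)
  then have z0: "Re z = 0" "z \<noteq> 0" using z by (auto simp: conj_pair_def)
  have zz: "- z\<^sup>2 = of_real (\<omega>\<^sup>2)" using z conj_pair_iff by blast
  \<comment> \<open>P_0 depends on z only through its square, so the rank assumed at i \<omega> is
    also the rank at - i \<omega>.\<close>
  have "z\<^sup>2 = ?z\<^sup>2" using z by (auto simp: conj_pair_def)
  then have ev: "eval_pmat P\<^sub>0 z = eval_pmat P\<^sub>0 ?z" by (simp add: eval_undamped_pmat[OF M K])
  obtain us where us: "null_basis (- z\<^sup>2) us" by (rule null_basis_exists)
  note pr = null_basis_properties[OF z0 us]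
  have p: "length us = p" using pr(1) rank by (simp add: undamped_P ev)
  show "geom_mult (P t) z = p" "alg_mult (P t) z = p" using pr(2,3)[OF t] p by auto
  show "z \<in> pmat_spectrum (P t) \<longleftrightarrow> p \<noteq> 0"
    using spectrum_imag_axis[OF t z0(1)] z0(2) null_basis_trivial_iff[OF us] p by auto
  show "mat_kernel (eval_pmat (P t) z) = null_modes (of_real (\<omega>\<^sup>2))"
    using kernel_imag_axis[OF t z0] zz by simp
  have "orthonormal_list M us" "set us \<subseteq> undamped.null_modes (- z\<^sup>2)"
    using us null_modes_undamped[of "- z\<^sup>2"] unfolding null_basis_def by blast+
  \<comment> \<open>The extended list has length m and begins with the p damped modes; it settles
    both p \<le> m and the equality of the two multiplicities for P_0.\<close>
  then obtain ws where ws: "undamped.null_basis (- z\<^sup>2) (us @ ws)"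
    by (rule undamped.null_basis_extend)
  note pr0 = undamped.null_basis_properties(2,3)[OF z0 ws, of 1, unfolded undamped_P]
  have g: "geom_mult P\<^sub>0 ?z = geom_mult P\<^sub>0 z" by (simp add: geom_mult_def ev)
  show "alg_mult P\<^sub>0 z = geom_mult P\<^sub>0 ?z" "p \<le> geom_mult P\<^sub>0 ?z"
    using pr0 p by (auto simp: g)
qed

lemma decoupling:
  fixes l :: nat and \<omega> :: "nat \<Rightarrow> real" and p :: "nat \<Rightarrow> nat"
  defines "\<sigma>\<^sub>0 \<equiv> (\<Union>j\<in>{1..l}. conj_pair (\<omega> j))"
  assumes inj: "inj_on (\<lambda>j. conj_pair (\<omega> j)) {1..l}"
    and spec: "pmat_spectrum (P 1) \<inter> imag_axis = \<sigma>\<^sub>0"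
    and rank: "\<forall>j\<in>{1..l}. vec_space.rank n (block_row (eval_pmat P\<^sub>0 (\<i> * of_real (\<omega> j))) D) + p j = n"
  shows "\<exists>X1 X2. X1 \<in> carrier_mat n (n - (\<Sum>j=1..l. p j)) \<and> X2 \<in> carrier_mat n (\<Sum>j=1..l. p j) \<and>
    m_unitary M (block_row X1 X2) \<and>
    (\<forall>t>0. congr_pmat (block_row X1 X2) (P t) = diag_block_mat [congr_pmat X1 (P t), oscillator_pmat l \<omega> p] \<and>
       (\<forall>z\<in>pmat_spectrum (congr_pmat X1 (P t)). Re z < 0) \<and>
       pmat_spectrum (congr_pmat X1 (P t)) = pmat_spectrum (P t) - \<sigma>\<^sub>0) \<and>
    pmat_spectrum (oscillator_pmat l \<omega> p) = \<sigma>\<^sub>0"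
proof -
  define \<mu> where "\<mu> j = complex_of_real ((\<omega> j)\<^sup>2)" for j
  have "\<forall>j. \<exists>us. null_basis (\<mu> j) us" by (metis null_basis_exists)
  then obtain U where U: "\<And>j. null_basis (\<mu> j) (U j)" by metis
  define us where "us = concat (map U [1..<Suc l])"
  define \<mu>s where "\<mu>s = concat (map (\<lambda>j. replicate (p j) (\<mu> j)) [1..<Suc l])"
  have mem: "j \<in> set [1..<Suc l] \<longleftrightarrow> j \<in> {1..l}" for j by auto
  \<comment> \<open>Each listed pair consists of eigenvalues, so no p j is zero. Otherwise \<omega>
    j would leave no trace in \<open>\<mu>s\<close>, and the oscillator block would miss that part
    of the spectrum.\<close>
  have lenU: "length (U j) = p j" and p_pos: "p j > 0" if j: "j \<in> {1..l}" for j
  proof -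
    let ?z = "\<i> * complex_of_real (\<omega> j)"
    have "?z \<in> conj_pair (\<omega> j)" by (simp add: conj_pair_def)
    then have i: "?z \<in> \<sigma>\<^sub>0" unfolding \<sigma>\<^sub>0_def using j by blast
    have z: "?z \<in> pmat_spectrum (P 1)" "Re ?z = 0" using spec i by auto
    then have nz: "?z \<noteq> 0" using spectrum_nonzero by blast
    have "- ?z\<^sup>2 = \<mu> j" by (simp add: \<mu>_def power_mult_distrib)
    then have nb: "null_basis (- ?z\<^sup>2) (U j)" using U by simp
    show "length (U j) = p j"
      using null_basis_properties(1)[OF z(2) nz nb] bspec[OF rank j] by (simp add: undamped_P)
    moreover have "U j \<noteq> []"
      using spectrum_imag_axis[of 1 ?z] z null_basis_trivial_iff[OF nb] by simp
    ultimately show "p j > 0" by (metis length_greater_0_conv)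
  qed
  \<comment> \<open>The pair is determined by its parameter, so distinct pairs have distinct real
    parameters and mutually orthogonal modes.\<close>
  have \<mu>_inj: "i = j" if "i \<in> {1..l}" "j \<in> {1..l}" "\<mu> i = \<mu> j" for i j
  proof -
    have "conj_pair (\<omega> i) = conj_pair (\<omega> j)"
      using that(3) by (auto simp: conj_pair_iff \<mu>_def)
    then show ?thesis using inj that by (auto dest: inj_onD)
  qed
  have on: "orthonormal_list M us"
    unfolding us_def
  proof (rule orthonormal_list_concat[OF M hermM])
    show "orthonormal_list M (U j)" for j using U by (simp add: null_basis_def)
    show "mform M u v = 0"
      if "i \<in> set [1..<Suc l]" "j \<in> set [1..<Suc l]" "i \<noteq> j" "u \<in> set (U i)" "v \<in> set (U j)" for i j u v
    proof (rule null_modes_orthogonal[of u "\<mu> i" v "\<mu> j"])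
      show "u \<in> null_modes (\<mu> i)" "v \<in> null_modes (\<mu> j)" using U that by (auto simp: null_basis_def)
      have "cnj (\<mu> j) = \<mu> j" by (simp add: \<mu>_def)
      then show "\<mu> i \<noteq> cnj (\<mu> j)" using that \<mu>_inj mem by metis
    qed
  qed simp
  have modes: "list_all2 (\<lambda>u m. u \<in> null_modes m) us \<mu>s"
  proof -
    have "list_all2 (\<lambda>u m. u \<in> null_modes m) (concat (map U js)) (concat (map (\<lambda>j. replicate (p j) (\<mu> j)) js))"
      if "set js \<subseteq> {1..l}" for js
      using that
    proof (induction js)
      case (Cons j js)
      have "U j ! k \<in> null_modes (\<mu> j)" if "k < p j" for k
        using U[of j] lenU[of j] Cons.prems that nth_mem[of k "U j"] by (auto simp: null_basis_def)
      then have "list_all2 (\<lambda>u m. u \<in> null_modes m) (U j) (replicate (p j) (\<mu> j))"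
        using lenU[of j] Cons.prems by (simp add: list_all2_conv_all_nth)
      then show ?case using Cons by (simp add: list_all2_appendI)
    qed simp
    then show ?thesis unfolding us_def \<mu>s_def using mem by blast
  qed
  obtain ws where ab: "adapted_basis n M D K ws us \<mu>s"
    using adapted_basisI[OF on, of \<mu>s] modes by (auto simp: list_all2_conv_all_nth)
  then interpret adapted_basis n M D K ws us \<mu>s .
  let ?X2 = "mat_of_cols n us" and ?X = "block_row X1 (mat_of_cols n us)"
  have len_sum: "length us = (\<Sum>j=1..l. p j)"
  proof -
    have "length us = (\<Sum>j\<leftarrow>[1..<Suc l]. length (U j))"
      by (simp add: us_def length_concat comp_def del: upt_Suc)
    also have "\<dots> = (\<Sum>j\<in>set [1..<Suc l]. length (U j))"
      by (rule sum_list_distinct_conv_sum_set) simp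
    also have "\<dots> = (\<Sum>j=1..l. p j)" by (intro sum.cong) (use lenU in auto)
    finally show ?thesis .
  qed
  have set_\<mu>s: "set \<mu>s = \<mu> ` {1..l}"
    unfolding \<mu>s_def using p_pos by (force simp del: upt_Suc)
  have \<sigma>: "- z\<^sup>2 \<in> set \<mu>s \<longleftrightarrow> z \<in> \<sigma>\<^sub>0" for z
    unfolding set_\<mu>s \<sigma>\<^sub>0_def by (auto simp: conj_pair_iff \<mu>_def)
  have osc: "oscillator_pmat l \<omega> p = mat_diag (length us) (\<lambda>k. map (\<lambda>\<mu>. [:\<mu>, 0, 1:]) \<mu>s ! k)"
    using oscillator_pmat_mat_diag[of l \<omega> p] len_us by (simp add: \<mu>s_def \<mu>_def del: upt_Suc)
  have X: "?X = mat_of_cols n (ws @ us)" by (simp only: mat_of_cols_append)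
  have "m_unitary M ?X"
    unfolding m_unitary_def X using orthonormal_list_gram[OF M on_all] M len
      mat_of_cols_carrier(1)[of n "ws @ us"] by simp
  moreover have "congr_pmat ?X (P t) = diag_block_mat [congr_pmat X1 (P t), oscillator_pmat l \<omega> p]" for t
  proof -
    have dims: "dim_row (congr_pmat X1 (P t)) = length ws" "dim_col (congr_pmat X1 (P t)) = length ws"
      using congr_X1 by blast+
    show ?thesis
      by (simp only: X congr_block osc diag_block_mat.simps(2)[of _ "[_]"] diag_block_mat_singleton Let_def
        dims mat_diag_dim[THEN carrier_matD(1)] mat_diag_dim[THEN carrier_matD(2)])
  qed
  moreover have neg: "Re z < 0" and not_\<sigma>: "z \<notin> \<sigma>\<^sub>0"
    if t: "t > 0" and z: "z \<in> pmat_spectrum (congr_pmat X1 (P t))" for t z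
  proof -
    have zP: "z \<in> pmat_spectrum (P t)" using z spectrum_congr_X1 by blast
    have "Re z \<noteq> 0"
    proof
      assume re: "Re z = 0"
      have z0: "z \<noteq> 0" using spectrum_nonzero[OF zP] .
      \<comment> \<open>An imaginary eigenvalue for t is one for t = 1, hence belongs to a listed
        pair. All modes of that pair are among \<open>us\<close>, so the compressed pencil is
        nonsingular there.\<close>
      have "z \<in> pmat_spectrum (P 1) \<inter> imag_axis"
        using zP re spectrum_imag_axis[OF t re] spectrum_imag_axis[of 1 z] by (simp add: imag_axis_def)
      then obtain j where j: "j \<in> {1..l}" "z \<in> conj_pair (\<omega> j)" using spec by (auto simp: \<sigma>\<^sub>0_def)
      have \<mu>j: "- z\<^sup>2 = \<mu> j" using j(2) by (simp add: conj_pair_iff \<mu>_def)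
      have sub: "set (U j) \<subseteq> set us" using j(1) mem by (auto simp: us_def simp del: upt_Suc)
      have "v = 0\<^sub>v n" if "v \<in> mat_kernel (eval_pmat (P t) z)" "\<forall>u \<in> set us. mform M v u = 0" for v
        using that U[of j] sub unfolding kernel_imag_axis[OF t re z0] \<mu>j null_basis_def by blast
      then show False using not_in_spectrum_congr_X1[of t z] z by blast
    qed
    then show "Re z < 0" "z \<notin> \<sigma>\<^sub>0"
      using spectrum_Re_le[OF t zP] conj_pair_Re by (auto simp: \<sigma>\<^sub>0_def)
  qed
  moreover have "pmat_spectrum (congr_pmat X1 (P t)) = pmat_spectrum (P t) - \<sigma>\<^sub>0" if "t > 0" for t
    using spectrum_congr_X1[of _ t] not_\<sigma>[OF that] \<sigma> by blast
  moreover have "pmat_spectrum (oscillator_pmat l \<omega> p) = \<sigma>\<^sub>0"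
  proof -
    have "det (oscillator_pmat l \<omega> p) = prod_list (map (\<lambda>\<mu>. [:\<mu>, 0, 1:]) \<mu>s)"
      unfolding osc using det_mat_diag[of "map (\<lambda>\<mu>. [:\<mu>, 0, 1:]) \<mu>s"] len_us by simp
    then show ?thesis
      using \<sigma> by (auto simp: pmat_spectrum_def poly_det_eval_pmat[symmetric] poly_oscillator_prod)
  qed
  moreover have "X1 \<in> carrier_mat n (n - (\<Sum>j=1..l. p j))" "?X2 \<in> carrier_mat n (\<Sum>j=1..l. p j)"
    using len len_sum mat_of_cols_carrier(1)[of n ws] mat_of_cols_carrier(1)[of n us] by auto
  ultimately show ?thesis by blast
qed

lemma imag_eigenvalue_invariant:
  assumes "s > 0" "t > 0" "z \<in> pmat_spectrum (P s) \<inter> imag_axis"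
  shows "z \<in> pmat_spectrum (P t)" "geom_mult (P t) z = geom_mult (P s) z"
proof -
  have z: "Re z = 0" "z \<noteq> 0" using assms spectrum_nonzero by (auto simp: imag_axis_def)
  show "z \<in> pmat_spectrum (P t)"
    using assms spectrum_imag_axis[OF assms(1) z(1)] spectrum_imag_axis[OF assms(2) z(1)] by blast
  obtain us where us: "null_basis (- z\<^sup>2) us" by (rule null_basis_exists)
  show "geom_mult (P t) z = geom_mult (P s) z"
    using null_basis_properties(2)[OF z us] assms by simp
qed

end

theorem corollary35:
  fixes n :: nat and M D K :: "complex mat"
  assumes "M \<in> carrier_mat n n" and "D \<in> carrier_mat n n" and "K \<in> carrier_mat n n"
    and "pos_definite M" and "pos_semidefinite D" and "pos_definite K"
  shows
    "(\<forall>t>0. pmat_spectrum (damped_pmat M D K t) \<inter> imag_axis \<subseteq> pmat_spectrum (undamped_pmat M K)) \<and>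
     (\<forall>\<omega>::real. \<forall>m::nat.
        \<i> * of_real \<omega> \<in> pmat_spectrum (undamped_pmat M K) \<and>
        m = geom_mult (undamped_pmat M K) (\<i> * of_real \<omega>) \<longrightarrow>
        (vec_space.rank n (block_row (eval_pmat (undamped_pmat M K) (\<i> * of_real \<omega>)) D) = n \<longrightarrow>
           (\<forall>t>0. \<forall>z\<in>conj_pair \<omega>. z \<notin> pmat_spectrum (damped_pmat M D K t))) \<and>
        (\<forall>p\<ge>1.
           vec_space.rank n (block_row (eval_pmat (undamped_pmat M K) (\<i> * of_real \<omega>)) D) + p = n \<longrightarrow>
           (\<forall>t>0.
              (\<forall>z\<in>conj_pair \<omega>. z \<in> pmat_spectrum (damped_pmat M D K t) \<and>
                 geom_mult (damped_pmat M D K t) z = p) \<and>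
              mat_kernel (eval_pmat (damped_pmat M D K t) (\<i> * of_real \<omega>)) =
                mat_kernel (eval_pmat (damped_pmat M D K 1) (\<i> * of_real \<omega>)))) \<and>
        (\<forall>p.
           vec_space.rank n (block_row (eval_pmat (undamped_pmat M K) (\<i> * of_real \<omega>)) D) + p = n \<longrightarrow>
           p \<le> m \<and>
           (\<forall>t>0. \<forall>z\<in>conj_pair \<omega>.
              alg_mult (undamped_pmat M K) z = m \<and> alg_mult (damped_pmat M D K t) z = p))) \<and>
     (\<forall>(l::nat) (\<omega>::nat \<Rightarrow> real) (p::nat \<Rightarrow> nat).
        inj_on (\<lambda>j. conj_pair (\<omega> j)) {1..l} \<and>
        pmat_spectrum (damped_pmat M D K 1) \<inter> imag_axis = (\<Union>j\<in>{1..l}. conj_pair (\<omega> j)) \<and>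
        (\<forall>j\<in>{1..l}.
           vec_space.rank n (block_row (eval_pmat (undamped_pmat M K) (\<i> * of_real (\<omega> j))) D) + p j = n) \<longrightarrow>
        (\<exists>X1 X2.
           X1 \<in> carrier_mat n (n - (\<Sum>j=1..l. p j)) \<and>
           X2 \<in> carrier_mat n (\<Sum>j=1..l. p j) \<and>
           m_unitary M (block_row X1 X2) \<and>
           (\<forall>t>0.
              congr_pmat (block_row X1 X2) (damped_pmat M D K t) =
                diag_block_mat [congr_pmat X1 (damped_pmat M D K t), oscillator_pmat l \<omega> p] \<and>
              (\<forall>z\<in>pmat_spectrum (congr_pmat X1 (damped_pmat M D K t)). Re z < 0) \<and>
              pmat_spectrum (congr_pmat X1 (damped_pmat M D K t)) =
                pmat_spectrum (damped_pmat M D K t) - (\<Union>j\<in>{1..l}. conj_pair (\<omega> j))) \<and>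
           pmat_spectrum (oscillator_pmat l \<omega> p) = (\<Union>j\<in>{1..l}. conj_pair (\<omega> j)))) \<and>
     (\<forall>s>0. \<forall>t>0. \<forall>z\<in>pmat_spectrum (damped_pmat M D K s) \<inter> imag_axis.
        z \<in> pmat_spectrum (damped_pmat M D K t) \<and>
        geom_mult (damped_pmat M D K t) z = geom_mult (damped_pmat M D K s) z)"
proof -
  interpret damped_system n M D K
    using assms by unfold_locales
  let ?r = "\<lambda>\<omega>. vec_space.rank n (block_row (eval_pmat P\<^sub>0 (\<i> * complex_of_real \<omega>)) D)"
  \<comment> \<open>Part (a) for a fixed \<omega>: its three claims are
    \<open>multiplicities\<close> with p = 0, with p \<ge> 1 and with arbitrary p.\<close>
  have a: "(?r \<omega> = n \<longrightarrow> (\<forall>t>0. \<forall>z\<in>conj_pair \<omega>. z \<notin> pmat_spectrum (P t))) \<and>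
      (\<forall>p\<ge>1. ?r \<omega> + p = n \<longrightarrow>
         (\<forall>t>0. (\<forall>z\<in>conj_pair \<omega>. z \<in> pmat_spectrum (P t) \<and> geom_mult (P t) z = p) \<and>
            mat_kernel (eval_pmat (P t) (\<i> * of_real \<omega>)) = mat_kernel (eval_pmat (P 1) (\<i> * of_real \<omega>)))) \<and>
      (\<forall>p. ?r \<omega> + p = n \<longrightarrow> p \<le> m \<and>
         (\<forall>t>0. \<forall>z\<in>conj_pair \<omega>. alg_mult P\<^sub>0 z = m \<and> alg_mult (P t) z = p))"
    if \<omega>: "\<i> * of_real \<omega> \<in> pmat_spectrum P\<^sub>0" and m: "m = geom_mult P\<^sub>0 (\<i> * of_real \<omega>)" for \<omega> :: real and m
  proof (intro conjI allI impI ballI)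
    note mult = multiplicities[OF \<omega>]
    have i: "\<i> * of_real \<omega> \<in> conj_pair \<omega>" by (simp add: conj_pair_def)
    show "z \<notin> pmat_spectrum (P t)" if "?r \<omega> = n" "t > 0" "z \<in> conj_pair \<omega>" for t z
      using mult(1)[of 0 t z] that by simp
    show "z \<in> pmat_spectrum (P t)" "geom_mult (P t) z = p"
      if "1 \<le> p" "?r \<omega> + p = n" "0 < t" "z \<in> conj_pair \<omega>" for p t z
      using mult(1,2)[OF that(2-)] that(1) by auto
    show "mat_kernel (eval_pmat (P t) (\<i> * of_real \<omega>)) = mat_kernel (eval_pmat (P 1) (\<i> * of_real \<omega>))"
      if "1 \<le> p" "?r \<omega> + p = n" "0 < t" for p t
      \<comment> \<open>Both nullspaces equal the same set of modes, whose description is free of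
        t.\<close>
      using mult(6)[OF that(2,3) i] mult(6)[OF that(2) _ i, of 1] by simp
    show "p \<le> m" if "?r \<omega> + p = n" for p
      using mult(5)[OF that _ i, of 1] m by simp
    show "alg_mult P\<^sub>0 z = m" "alg_mult (P t) z = p"
      if "?r \<omega> + p = n" "0 < t" "z \<in> conj_pair \<omega>" for p t z
      using mult(3,4)[OF that] m by auto
  qed
  show ?thesis
  proof (rule conjI[OF _ conjI[OF _ conjI]], goal_cases)
    case 1
    show ?case using spectrum_imag_axis_subset by blast
  next
    case 2
    show ?case by (intro allI impI, elim conjE, rule a)
  next
    case 3
    show ?case by (intro allI impI, elim conjE, rule decoupling)
  next
    case 4
    show ?case using imag_eigenvalue_invariant by blast
  qed
qed

end
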